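(* Let $(\omega_1,\omega_2,\omega_3)$ be an $\boldsymbol\varepsilon$-hypersymplectic structure on a Lie algebroid $(A,\rho,[\cdot,\cdot])$ such that $\varepsilon_1\varepsilon_2\varepsilon_3=1$, with inverse Poisson bivectors $\pi_i$ and induced $2$-form $g$ and bivector $g^{-1}$. Then, for all $i\in\{1,2,3\}$, the pairs $(\pi_i,g)$ and $(g^{-1},\omega_i)$ are $P\Omega$ structures on $A$.
   Context: Let $\mathrm d$ denote the differential of the Lie algebroid. For a $2$-form $\omega\in\Gamma(\bigwedge^2A^* )$, $\langle\omega^\flat(X),Y\rangle=\omega(X,Y)$; for a bivector $\pi\in\Gamma(\bigwedge^2A)$, $\langle\beta,\pi^\sharp(\alpha)\rangle=\pi(\alpha,\beta)$. A symplectic form is a closed non-degenerate $2$-form; its inverse Poisson bivector $\pi$ satisfies $\omega^\flat\circ\pi^\sharp=\mathrm{Id}_{A^*}$, $\pi^\sharp\circ\omega^\flat=\mathrm{Id}_A$. All indices are in $\mathbb{Z}_3=\{1,2,3\}$. Given symplectic forms $\omega_1,\omega_2,\omega_3$ with inverses $\pi_1,\pi_2,\pi_3$, the transition tensors are $N_i:=\pi_{i-1}^\sharp\circ\omega_{i+1}^\flat$. The triple is an $\boldsymbol\varepsilon$-hypersymplectic structure, $\boldsymbol\varepsilon=(\varepsilon_1,\varepsilon_2,\varepsilon_3)$ with $\varepsilon_i=\pm1$, if $N_i^2=\varepsilon_i\mathrm{Id}_A$ for $i=1,2,3$. The induced tensor $g\in\Gamma(\bigotimes^2A^* )$ is $g(X,Y)=\langle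 g^\flat X,Y\rangle$ with $g^\flat:=\varepsilon_3\varepsilon_2\,\omega_3^\flat\circ\pi_1^\sharp\circ\omega_2^\flat$, and $g^{-1}(\alpha,\beta):=\langle(g^\flat)^{-1}(\alpha),\beta\rangle$; when $\varepsilon_1\varepsilon_2\varepsilon_3=1$, $g$ is a $2$-form and $g^{-1}$ a bivector. A pair $(\pi,\omega)$ of a bivector and a $2$-form on $A$ is a $P\Omega$ structure if $[\pi,\pi]=0$ (Schouten–Nijenhuis bracket), $\mathrm d\omega=0$ and $\mathrm d(\omega_N)=0$, where $N=\pi^\sharp\circ\omega^\flat$ and $\omega_N(X,Y)=\omega(NX,Y)$, i.e. $\omega_N^\flat=\omega^\flat\circ N$. *)

theory Defs
  imports "HOL-Analysis.Analysis"
begin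

section \<open>Smooth functions on open subsets of Euclidean n-space\<close>

text \<open>
  The dimension is a natural number \<open>n\<close>, possibly \<open>0\<close>, and \<open>\<real>\<^sup>n\<close> is the space
  \<open>Euclidean_space n\<close> of sequences that vanish from position \<open>n\<close> on.  A function is of class
  \<open>C\<^sup>k\<close> if its iterated partial derivatives up to order \<open>k\<close> exist and are continuous.
\<close>

definition partial_deriv :: "nat \<Rightarrow> ((nat \<Rightarrow> real) \<Rightarrow> real) \<Rightarrow> (nat \<Rightarrow> real) \<Rightarrow> real" where
  "partial_deriv i f p = deriv (\<lambda>t. f (p(i := t))) (p i)"

primrec Ck_on :: "nat \<Rightarrow> nat \<Rightarrow> (nat \<Rightarrow> real) set \<Rightarrow> ((nat \<Rightarrow> real) \<Rightarrow> real) \<Rightarrow> bool" where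
  "Ck_on n 0 V f \<longleftrightarrow> continuous_map (subtopology (Euclidean_space n) V) euclideanreal f"
| "Ck_on n (Suc k) V f \<longleftrightarrow>
     continuous_map (subtopology (Euclidean_space n) V) euclideanreal f \<and>
     (\<forall>i<n. (\<forall>p\<in>V. (\<lambda>t. f (p(i := t))) differentiable (at (p i))) \<and>
            Ck_on n k V (partial_deriv i f))"

definition smooth_on_Rn :: "nat \<Rightarrow> (nat \<Rightarrow> real) set \<Rightarrow> ((nat \<Rightarrow> real) \<Rightarrow> real) \<Rightarrow> bool" where
  "smooth_on_Rn n V f \<longleftrightarrow> (\<forall>k. Ck_on n k V f)"


section \<open>Smooth manifolds\<close>

text \<open>
  The manifold is the whole type \<open>'m\<close>; the Hausdorff property and second countability are
  expressed by type classes.  The atlas need not be maximal.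
\<close>

record 'm manifold =
  mdim :: nat
  charts :: "('m set \<times> ('m \<Rightarrow> nat \<Rightarrow> real)) set"

definition smooth_manifold :: "('m::{t2_space,second_countable_topology}, 'z) manifold_scheme \<Rightarrow> bool"
  where
  "smooth_manifold M \<longleftrightarrow>
     (\<forall>(U, c)\<in>charts M. open U \<and> openin (Euclidean_space (mdim M)) (c ` U) \<and>
        homeomorphic_map (top_of_set U) (subtopology (Euclidean_space (mdim M)) (c ` U)) c) \<and>
     (\<Union>(U, c)\<in>charts M. U) = UNIV \<and>
     (\<forall>(U, c)\<in>charts M. \<forall>(V, c')\<in>charts M. \<forall>i<mdim M.
        smooth_on_Rn (mdim M) (c ` (U \<inter> V)) (\<lambda>p. c' (inv_into U c p) i))"

definition smooth_fun_on ::
  "('m::{t2_space,second_countable_topology}, 'z) manifold_scheme \<Rightarrow> 'm set \<Rightarrow> ('m \<Rightarrow> real) \<Rightarrow> bool"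
  where
  "smooth_fun_on M W f \<longleftrightarrow>
     (\<forall>(U, c)\<in>charts M. smooth_on_Rn (mdim M) (c ` (U \<inter> W)) (\<lambda>p. f (inv_into U c p)))"

abbreviation smooth_fun ::
  "('m::{t2_space,second_countable_topology}, 'z) manifold_scheme \<Rightarrow> ('m \<Rightarrow> real) \<Rightarrow> bool" where
  "smooth_fun M \<equiv> smooth_fun_on M UNIV"

text \<open>Tangent vectors at \<open>x\<close> are the derivations at \<open>x\<close> of the algebra of smooth functions; their
  values on other functions are irrelevant.\<close>

definition tangent_space ::
  "('m::{t2_space,second_countable_topology}, 'z) manifold_scheme \<Rightarrow> 'm \<Rightarrow> (('m \<Rightarrow> real) \<Rightarrow> real) set"
  where
  "tangent_space M x = {D. \<forall>f g. smooth_fun M f \<longrightarrow> smooth_fun M g \<longrightarrow>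
      D (\<lambda>y. f y + g y) = D f + D g \<and>
      (\<forall>c. D (\<lambda>y. c * f y) = c * D f) \<and>
      D (\<lambda>y. f y * g y) = f x * D g + g x * D f}"


section \<open>Vector bundles\<close>

text \<open>
  The fibre over \<open>x\<close> is a subspace \<open>fibre E x\<close> of a real vector space \<open>'v\<close>.  The ambient space
  only provides the linear operations on the fibres: it carries no topology, and fibres over
  different points are unrelated in it.  The smooth structure of the bundle is given by the
  family \<open>frames E\<close> of local frames \<open>(U, e)\<close>, where \<open>e 0, \<dots>, e (rk E - 1)\<close> is a basis
  of the fibre at every point of the open set \<open>U\<close>; a local frame is the same as a local
  trivialisation.
\<close>

record ('m, 'v) vbundle = "'m manifold" +
  rk :: nat
  fibre :: "'m \<Rightarrow> 'v set"
  frames :: "('m set \<times> (nat \<Rightarrow> 'm \<Rightarrow> 'v)) set"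

text \<open>\<open>coframe E e x i\<close> is the \<open>i\<close>-th covector of the basis dual to the frame \<open>e\<close> at \<open>x\<close>;
  it is \<open>0\<close> outside the span of the frame, that is, outside the fibre.\<close>

definition coframe :: "('m, 'v::real_vector, 'z) vbundle_scheme \<Rightarrow> (nat \<Rightarrow> 'm \<Rightarrow> 'v) \<Rightarrow> 'm \<Rightarrow> nat \<Rightarrow> 'v \<Rightarrow> real"
  where
  "coframe E e x i v = representation ((\<lambda>j. e j x) ` {..<rk E}) v (e i x)"

definition vector_bundle ::
  "('m::{t2_space,second_countable_topology}, 'v::real_vector, 'z) vbundle_scheme \<Rightarrow> bool" where
  "vector_bundle E \<longleftrightarrow>
     smooth_manifold E \<and>
     (\<forall>x. subspace (fibre E x)) \<and>
     (\<forall>(U, e)\<in>frames E. open U \<and>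
        (\<forall>x\<in>U. inj_on (\<lambda>i. e i x) {..<rk E} \<and>
               independent ((\<lambda>i. e i x) ` {..<rk E}) \<and>
               span ((\<lambda>i. e i x) ` {..<rk E}) = fibre E x)) \<and>
     (\<Union>(U, e)\<in>frames E. U) = UNIV \<and>
     (\<forall>(U, e)\<in>frames E. \<forall>(V, e')\<in>frames E. \<forall>i<rk E. \<forall>j<rk E.
        smooth_fun_on E (U \<inter> V) (\<lambda>x. coframe E e x i (e' j x)))"

definition sections ::
  "('m::{t2_space,second_countable_topology}, 'v::real_vector, 'z) vbundle_scheme \<Rightarrow> ('m \<Rightarrow> 'v) set"
  where
  "sections E = {X. (\<forall>x. X x \<in> fibre E x) \<and>
     (\<forall>(U, e)\<in>frames E. \<forall>i<rk E. smooth_fun_on E U (\<lambda>x. coframe E e x i (X x)))}"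

text \<open>A covector at \<open>x\<close> is a linear form on the fibre; it is represented by the function on
  \<open>'v\<close> that extends it by \<open>0\<close>, so that equality of covectors is equality of functions.\<close>

definition dual :: "('m, 'v::real_vector, 'z) vbundle_scheme \<Rightarrow> 'm \<Rightarrow> ('v \<Rightarrow> real) set" where
  "dual E x = {\<phi>. (\<forall>u\<in>fibre E x. \<forall>v\<in>fibre E x. \<phi> (u + v) = \<phi> u + \<phi> v) \<and>
                  (\<forall>c. \<forall>u\<in>fibre E x. \<phi> (c *\<^sub>R u) = c * \<phi> u) \<and>
                  (\<forall>v. v \<notin> fibre E x \<longrightarrow> \<phi> v = 0)}"

definition dual_sections ::
  "('m::{t2_space,second_countable_topology}, 'v::real_vector, 'z) vbundle_scheme \<Rightarrow> ('m \<Rightarrow> 'v \<Rightarrow> real) set"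
  where
  "dual_sections E = {\<alpha>. (\<forall>x. \<alpha> x \<in> dual E x) \<and>
     (\<forall>(U, e)\<in>frames E. \<forall>i<rk E. smooth_fun_on E U (\<lambda>x. \<alpha> x (e i x)))}"

type_synonym ('m, 'v) tensor02 = "'m \<Rightarrow> 'v \<Rightarrow> 'v \<Rightarrow> real"
type_synonym ('m, 'v) tensor20 = "'m \<Rightarrow> ('v \<Rightarrow> real) \<Rightarrow> ('v \<Rightarrow> real) \<Rightarrow> real"

definition two_form ::
  "('m::{t2_space,second_countable_topology}, 'v::real_vector, 'z) vbundle_scheme \<Rightarrow> ('m, 'v) tensor02 \<Rightarrow> bool"
  where
  "two_form E \<omega> \<longleftrightarrow>
     (\<forall>x. \<forall>u\<in>fibre E x. \<forall>v\<in>fibre E x. \<forall>w\<in>fibre E x.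
        \<omega> x (u + v) w = \<omega> x u w + \<omega> x v w \<and>
        (\<forall>c. \<omega> x (c *\<^sub>R u) w = c * \<omega> x u w) \<and>
        \<omega> x u w = - \<omega> x w u) \<and>
     (\<forall>(U, e)\<in>frames E. \<forall>i<rk E. \<forall>j<rk E. smooth_fun_on E U (\<lambda>x. \<omega> x (e i x) (e j x)))"

text \<open>Bivectors in \<open>\<Lambda>\<^sup>2 E\<^sub>x\<close> are identified with the alternating bilinear forms on the dual fibre.\<close>

definition bivector_field ::
  "('m::{t2_space,second_countable_topology}, 'v::real_vector, 'z) vbundle_scheme \<Rightarrow> ('m, 'v) tensor20 \<Rightarrow> bool"
  where
  "bivector_field E \<pi> \<longleftrightarrow>
     (\<forall>x. \<forall>\<phi>\<in>dual E x. \<forall>\<psi>\<in>dual E x. \<forall>\<theta>\<in>dual E x.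
        \<pi> x (\<lambda>v. \<phi> v + \<psi> v) \<theta> = \<pi> x \<phi> \<theta> + \<pi> x \<psi> \<theta> \<and>
        (\<forall>c. \<pi> x (\<lambda>v. c * \<phi> v) \<theta> = c * \<pi> x \<phi> \<theta>) \<and>
        \<pi> x \<phi> \<theta> = - \<pi> x \<theta> \<phi>) \<and>
     (\<forall>(U, e)\<in>frames E. \<forall>i<rk E. \<forall>j<rk E.
        smooth_fun_on E U (\<lambda>x. \<pi> x (coframe E e x i) (coframe E e x j)))"

definition flat :: "('m, 'v::real_vector, 'z) vbundle_scheme \<Rightarrow> ('m, 'v) tensor02 \<Rightarrow> 'm \<Rightarrow> 'v \<Rightarrow> 'v \<Rightarrow> real"
  where
  "flat E \<omega> x u = (\<lambda>v. if v \<in> fibre E x then \<omega> x u v else 0)"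

definition sharp :: "('m, 'v::real_vector, 'z) vbundle_scheme \<Rightarrow> ('m, 'v) tensor20 \<Rightarrow> 'm \<Rightarrow> ('v \<Rightarrow> real) \<Rightarrow> 'v"
  where
  "sharp E \<pi> x \<phi> = (THE v. v \<in> fibre E x \<and> (\<forall>\<psi>\<in>dual E x. \<psi> v = \<pi> x \<phi> \<psi>))"


section \<open>Lie algebroids\<close>

text \<open>The anchor is a vector bundle morphism to the tangent bundle: \<open>anchor A x v\<close> is the tangent
  vector at \<open>x\<close>, a derivation, assigned to \<open>v\<close> in the fibre over \<open>x\<close>.  That the anchor is a
  homomorphism of brackets is a consequence of the axioms.\<close>

record ('m, 'v) algebroid = "('m, 'v) vbundle" +
  anchor :: "'m \<Rightarrow> 'v \<Rightarrow> ('m \<Rightarrow> real) \<Rightarrow> real"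
  bracket :: "('m \<Rightarrow> 'v) \<Rightarrow> ('m \<Rightarrow> 'v) \<Rightarrow> 'm \<Rightarrow> 'v"

definition anchor_deriv :: "('m, 'v, 'z) algebroid_scheme \<Rightarrow> ('m \<Rightarrow> 'v) \<Rightarrow> ('m \<Rightarrow> real) \<Rightarrow> 'm \<Rightarrow> real" where
  "anchor_deriv A X f x = anchor A x (X x) f"

definition lie_algebroid ::
  "('m::{t2_space,second_countable_topology}, 'v::real_vector, 'z) algebroid_scheme \<Rightarrow> bool" where
  "lie_algebroid A \<longleftrightarrow>
     vector_bundle A \<and>
     (\<forall>x. \<forall>u\<in>fibre A x. anchor A x u \<in> tangent_space A x) \<and>
     (\<forall>x. \<forall>u\<in>fibre A x. \<forall>v\<in>fibre A x. \<forall>f. smooth_fun A f \<longrightarrow>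
        anchor A x (u + v) f = anchor A x u f + anchor A x v f \<and>
        (\<forall>c. anchor A x (c *\<^sub>R u) f = c * anchor A x u f)) \<and>
     (\<forall>X\<in>sections A. \<forall>f. smooth_fun A f \<longrightarrow> smooth_fun A (anchor_deriv A X f)) \<and>
     (\<forall>X\<in>sections A. \<forall>Y\<in>sections A. bracket A X Y \<in> sections A) \<and>
     (\<forall>X\<in>sections A. \<forall>Y\<in>sections A. \<forall>Z\<in>sections A. \<forall>c x.
        bracket A X (\<lambda>y. Y y + Z y) x = bracket A X Y x + bracket A X Z x \<and>
        bracket A X (\<lambda>y. c *\<^sub>R Y y) x = c *\<^sub>R bracket A X Y x \<and>
        bracket A X Y x = - bracket A Y X x \<and>
        bracket A X (bracket A Y Z) x + bracket A Y (bracket A Z X) x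
          + bracket A Z (bracket A X Y) x = 0) \<and>
     (\<forall>X\<in>sections A. \<forall>Y\<in>sections A. \<forall>f x. smooth_fun A f \<longrightarrow>
        bracket A X (\<lambda>y. f y *\<^sub>R Y y) x = f x *\<^sub>R bracket A X Y x + anchor_deriv A X f x *\<^sub>R Y x)"

definition d_one ::
  "('m, 'v, 'z) algebroid_scheme \<Rightarrow> ('m \<Rightarrow> 'v \<Rightarrow> real) \<Rightarrow> ('m \<Rightarrow> 'v) \<Rightarrow> ('m \<Rightarrow> 'v) \<Rightarrow> 'm \<Rightarrow> real" where
  "d_one A \<alpha> X Y x =
     anchor_deriv A X (\<lambda>y. \<alpha> y (Y y)) x - anchor_deriv A Y (\<lambda>y. \<alpha> y (X y)) x
     - \<alpha> x (bracket A X Y x)"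

definition d_two ::
  "('m, 'v, 'z) algebroid_scheme \<Rightarrow> ('m, 'v) tensor02 \<Rightarrow>
     ('m \<Rightarrow> 'v) \<Rightarrow> ('m \<Rightarrow> 'v) \<Rightarrow> ('m \<Rightarrow> 'v) \<Rightarrow> 'm \<Rightarrow> real" where
  "d_two A \<omega> X Y Z x =
     anchor_deriv A X (\<lambda>y. \<omega> y (Y y) (Z y)) x
     - anchor_deriv A Y (\<lambda>y. \<omega> y (X y) (Z y)) x
     + anchor_deriv A Z (\<lambda>y. \<omega> y (X y) (Y y)) x
     - \<omega> x (bracket A X Y x) (Z x) + \<omega> x (bracket A X Z x) (Y x) - \<omega> x (bracket A Y Z x) (X x)"

definition closed_form ::
  "('m::{t2_space,second_countable_topology}, 'v::real_vector, 'z) algebroid_scheme \<Rightarrow> ('m, 'v) tensor02 \<Rightarrow> bool"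
  where
  "closed_form A \<omega> \<longleftrightarrow>
     (\<forall>X\<in>sections A. \<forall>Y\<in>sections A. \<forall>Z\<in>sections A. \<forall>x. d_two A \<omega> X Y Z x = 0)"

text \<open>
  The Schouten--Nijenhuis bracket of two bivector fields, a trivector field, evaluated on three
  sections of the dual bundle.  The formula arises from
  \<open>i\<^bsub>[P,Q]\<^esub> = i\<^sub>P d i\<^sub>Q + i\<^sub>Q d i\<^sub>P - i\<^bsub>P\<and>Q\<^esub> d\<close> on \<open>3\<close>-forms \<open>\<alpha> \<and> \<beta> \<and> \<gamma>\<close>,
  where \<open>i\<^bsub>X\<and>Y\<^esub> = i\<^sub>X i\<^sub>Y\<close>.  Lemma
  \<open>schouten_wedge_sum\<close> below shows that the bracket is the biadditive extension of
  \<open>[X\<and>Y, U\<and>V] = [X,U]\<and>Y\<and>V - [X,V]\<and>Y\<and>U - [Y,U]\<and>X\<and>V + [Y,V]\<and>X\<and>U\<close>.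
\<close>

definition schouten ::
  "('m, 'v::real_vector, 'z) algebroid_scheme \<Rightarrow> ('m, 'v) tensor20 \<Rightarrow> ('m, 'v) tensor20 \<Rightarrow>
     ('m \<Rightarrow> 'v \<Rightarrow> real) \<Rightarrow> ('m \<Rightarrow> 'v \<Rightarrow> real) \<Rightarrow> ('m \<Rightarrow> 'v \<Rightarrow> real) \<Rightarrow> 'm \<Rightarrow> real" where
  "schouten A P Q \<alpha> \<beta> \<gamma> x =
     (let s = (\<lambda>R \<kappa> y. sharp A R y (\<kappa> y));
          t = (\<lambda>\<alpha> \<beta> \<gamma>.
                 anchor_deriv A (s P \<alpha>) (\<lambda>y. Q y (\<beta> y) (\<gamma> y)) x
               + anchor_deriv A (s Q \<alpha>) (\<lambda>y. P y (\<beta> y) (\<gamma> y)) x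
               - d_one A \<alpha> (s P \<beta>) (s Q \<gamma>) x
               - d_one A \<alpha> (s Q \<beta>) (s P \<gamma>) x)
      in t \<alpha> \<beta> \<gamma> + t \<beta> \<gamma> \<alpha> + t \<gamma> \<alpha> \<beta>)"

definition poisson ::
  "('m::{t2_space,second_countable_topology}, 'v::real_vector, 'z) algebroid_scheme \<Rightarrow> ('m, 'v) tensor20 \<Rightarrow> bool"
  where
  "poisson A \<pi> \<longleftrightarrow>
     (\<forall>\<alpha>\<in>dual_sections A. \<forall>\<beta>\<in>dual_sections A. \<forall>\<gamma>\<in>dual_sections A. \<forall>x.
        schouten A \<pi> \<pi> \<alpha> \<beta> \<gamma> x = 0)"


section \<open>Hypersymplectic and P-Omega structures\<close>

definition symplectic_form ::
  "('m::{t2_space,second_countable_topology}, 'v::real_vector, 'z) algebroid_scheme \<Rightarrow> ('m, 'v) tensor02 \<Rightarrow> bool"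
  where
  "symplectic_form A \<omega> \<longleftrightarrow> two_form A \<omega> \<and> closed_form A \<omega> \<and>
     (\<forall>x. \<forall>u\<in>fibre A x. (\<forall>v\<in>fibre A x. \<omega> x u v = 0) \<longrightarrow> u = 0)"

definition inverse_bivector ::
  "('m::{t2_space,second_countable_topology}, 'v::real_vector, 'z) algebroid_scheme \<Rightarrow>
     ('m, 'v) tensor02 \<Rightarrow> ('m, 'v) tensor20 \<Rightarrow> bool" where
  "inverse_bivector A \<omega> \<pi> \<longleftrightarrow> bivector_field A \<pi> \<and>
     (\<forall>x. \<forall>\<phi>\<in>dual A x. flat A \<omega> x (sharp A \<pi> x \<phi>) = \<phi>) \<and>
     (\<forall>x. \<forall>u\<in>fibre A x. sharp A \<pi> x (flat A \<omega> x u) = u)"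

text \<open>The index set \<open>\<int>\<^sub>3\<close> is the numeral type \<open>3\<close>, whose arithmetic is modulo \<open>3\<close>.\<close>

definition transition ::
  "('m, 'v::real_vector, 'z) algebroid_scheme \<Rightarrow> (3 \<Rightarrow> ('m, 'v) tensor02) \<Rightarrow> (3 \<Rightarrow> ('m, 'v) tensor20) \<Rightarrow>
     3 \<Rightarrow> 'm \<Rightarrow> 'v \<Rightarrow> 'v" where
  "transition A \<omega> \<pi> i x u = sharp A (\<pi> (i - 1)) x (flat A (\<omega> (i + 1)) x u)"

definition hypersymplectic ::
  "('m::{t2_space,second_countable_topology}, 'v::real_vector, 'z) algebroid_scheme \<Rightarrow>
     (3 \<Rightarrow> real) \<Rightarrow> (3 \<Rightarrow> ('m, 'v) tensor02) \<Rightarrow> (3 \<Rightarrow> ('m, 'v) tensor20) \<Rightarrow> bool" where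
  "hypersymplectic A \<epsilon> \<omega> \<pi> \<longleftrightarrow>
     (\<forall>i. \<epsilon> i = 1 \<or> \<epsilon> i = - 1) \<and>
     (\<forall>i. symplectic_form A (\<omega> i)) \<and>
     (\<forall>i. inverse_bivector A (\<omega> i) (\<pi> i)) \<and>
     (\<forall>i x. \<forall>u\<in>fibre A x. transition A \<omega> \<pi> i x (transition A \<omega> \<pi> i x u) = \<epsilon> i *\<^sub>R u)"

definition induced_tensor ::
  "('m, 'v::real_vector, 'z) algebroid_scheme \<Rightarrow> (3 \<Rightarrow> real) \<Rightarrow> (3 \<Rightarrow> ('m, 'v) tensor02) \<Rightarrow>
     (3 \<Rightarrow> ('m, 'v) tensor20) \<Rightarrow> ('m, 'v) tensor02" where
  "induced_tensor A \<epsilon> \<omega> \<pi> x u v =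
     \<epsilon> 3 * \<epsilon> 2 * flat A (\<omega> 3) x (sharp A (\<pi> 1) x (flat A (\<omega> 2) x u)) v"

definition inverse_tensor ::
  "('m, 'v::real_vector, 'z) algebroid_scheme \<Rightarrow> ('m, 'v) tensor02 \<Rightarrow> ('m, 'v) tensor20" where
  "inverse_tensor A g x \<phi> \<psi> = \<psi> (inv_into (fibre A x) (flat A g x) \<phi>)"

definition P_Omega ::
  "('m::{t2_space,second_countable_topology}, 'v::real_vector, 'z) algebroid_scheme \<Rightarrow>
     ('m, 'v) tensor20 \<Rightarrow> ('m, 'v) tensor02 \<Rightarrow> bool" where
  "P_Omega A \<pi> \<omega> \<longleftrightarrow> bivector_field A \<pi> \<and> two_form A \<omega> \<and> poisson A \<pi> \<and> closed_form A \<omega> \<and>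
     closed_form A (\<lambda>x u v. \<omega> x (sharp A \<pi> x (flat A \<omega> x u)) v)"


section \<open>The Schouten--Nijenhuis bracket on sums of decomposable bivectors\<close>

text \<open>Nothing in this section is used by the definitions above.\<close>

lemma continuous_map_Euclidean_subtopology:
  assumes "openin (Euclidean_space n) V"
  shows "continuous_map (subtopology (Euclidean_space n) V) euclideanreal f \<longleftrightarrow> continuous_on V f"
proof -
  have "Euclidean_space n = top_of_set {p. \<forall>i\<ge>n. p i = 0}"
    by (simp add: Euclidean_space_def euclidean_product_topology)
  moreover have "V \<subseteq> {p. \<forall>i\<ge>n. p i = 0}"
    using openin_subset[OF assms] by (simp add: topspace_Euclidean_space)
  ultimately show ?thesis
    by (simp add: subtopology_subtopology inf.absorb2)
qed

lemma eventually_fun_upd_in: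
  assumes "openin (Euclidean_space n) V" "p \<in> V" "i < n"
  shows "\<forall>\<^sub>F t in nhds (p i). p(i := t) \<in> V"
proof -
  have p0: "\<And>j. j \<ge> n \<Longrightarrow> p j = 0"
    using openin_subset[OF assms(1)] assms(2) by (auto simp: topspace_Euclidean_space)
  have "continuous_map euclideanreal (Euclidean_space n) (\<lambda>t j. if j < n then (p(i := t)) j else 0)"
    unfolding continuous_map_componentwise_Euclidean_space by (auto simp: fun_upd_def)
  moreover have "(\<lambda>t j. if j < n then (p(i := t)) j else 0) = (\<lambda>t. p(i := t))"
  proof (intro ext)
    fix t j
    show "(if j < n then (p(i := t)) j else 0) = (p(i := t)) j"
      using p0[of j] assms(3) by (cases "j < n") simp_all
  qed
  ultimately have "continuous_map euclideanreal (Euclidean_space n) (\<lambda>t. p(i := t))"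
    by simp
  from openin_continuous_map_preimage[OF this assms(1)] have "open {t. p(i := t) \<in> V}"
    by simp
  then show ?thesis
    unfolding eventually_nhds using assms(2) by (intro exI[of _ "{t. p(i := t) \<in> V}"]) simp
qed

lemma Ck_on_imp_continuous:
  "Ck_on n k V f \<Longrightarrow> openin (Euclidean_space n) V \<Longrightarrow> continuous_on V f"
  by (cases k) (auto simp: continuous_map_Euclidean_subtopology)

lemma Ck_on_Suc_imp: "Ck_on n (Suc k) V f \<Longrightarrow> Ck_on n k V f"
proof (induction k arbitrary: f)
  case (Suc k)
  show ?case
    unfolding Ck_on.simps(2)[of n k]
  proof (intro conjI allI impI)
    fix i assume "i < n"
    then show "Ck_on n k V (partial_deriv i f)"
      using Suc.IH[of "partial_deriv i f"] Suc.prems unfolding Ck_on.simps(2)[of n "Suc k"] by blast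
  qed (use Suc.prems in auto)
qed simp

lemma partial_deriv_cong:
  assumes "openin (Euclidean_space n) V" "p \<in> V" "i < n" "\<And>q. q \<in> V \<Longrightarrow> f q = g q"
  shows "partial_deriv i f p = partial_deriv i g p"
  unfolding partial_deriv_def
  using eventually_fun_upd_in[OF assms(1-3)]
  by (intro deriv_cong_ev refl) (auto elim!: eventually_mono simp: assms(4))

lemma differentiable_cong_upd:
  assumes "openin (Euclidean_space n) V" "p \<in> V" "i < n" "\<And>q. q \<in> V \<Longrightarrow> f q = g q"
    "(\<lambda>t. f (p(i := t))) differentiable (at (p i))"
  shows "(\<lambda>t. g (p(i := t :: real)) :: real) differentiable (at (p i))"
proof -
  obtain D where "DERIV (\<lambda>t. f (p(i := t))) (p i) :> D"
    using assms(5) by (auto simp: real_differentiable_def)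
  moreover have "\<forall>\<^sub>F t in nhds (p i). f (p(i := t)) = g (p(i := t))"
    using eventually_fun_upd_in[OF assms(1-3)] by (auto elim!: eventually_mono simp: assms(4))
  ultimately have "DERIV (\<lambda>t. g (p(i := t))) (p i) :> D"
    using DERIV_cong_ev[of "p i" "p i" "\<lambda>t. f (p(i := t))" "\<lambda>t. g (p(i := t))" D D] by simp
  then show ?thesis by (auto simp: real_differentiable_def)
qed

lemma Ck_on_cong:
  assumes V: "openin (Euclidean_space n) V" and "\<And>q. q \<in> V \<Longrightarrow> f q = g q" "Ck_on n k V f"
  shows "Ck_on n k V g"
  using assms(2,3)
proof (induction k arbitrary: f g)
  case 0
  have "continuous_on V f" using 0(2) by (simp add: continuous_map_Euclidean_subtopology[OF V])
  then have "continuous_on V g" by (rule continuous_on_eq) (fact 0(1))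
  then show ?case by (simp add: continuous_map_Euclidean_subtopology[OF V])
next
  case (Suc k)
  have f: "continuous_on V f" "\<And>i p. i < n \<Longrightarrow> p \<in> V \<Longrightarrow> (\<lambda>t. f (p(i := t))) differentiable (at (p i))"
    "\<And>i. i < n \<Longrightarrow> Ck_on n k V (partial_deriv i f)"
    using Suc.prems(2) by (auto simp: continuous_map_Euclidean_subtopology[OF V])
  have "continuous_on V g" using f(1) by (rule continuous_on_eq) (fact Suc.prems(1))
  moreover have "Ck_on n k V (partial_deriv i g)" if "i < n" for i
  proof (rule Suc.IH)
    show "partial_deriv i f q = partial_deriv i g q" if "q \<in> V" for q
      by (rule partial_deriv_cong[OF V that \<open>i < n\<close> Suc.prems(1)])
  qed (rule f(3)[OF that])
  moreover have "(\<lambda>t. g (p(i := t))) differentiable (at (p i))" if "i < n" "p \<in> V" for i p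
    by (rule differentiable_cong_upd[OF V that(2,1) Suc.prems(1) f(2)[OF that]])
  ultimately show ?case
    by (simp add: continuous_map_Euclidean_subtopology[OF V])
qed

lemma Ck_on_const: "openin (Euclidean_space n) V \<Longrightarrow> Ck_on n k V (\<lambda>_. c)"
  by (induction k arbitrary: c) (simp_all add: partial_deriv_def[abs_def])

lemma has_partial_deriv:
  assumes "(\<lambda>t. f (p(i := t))) differentiable (at (p i :: real))"
  shows "((\<lambda>t. f (p(i := t)) :: real) has_field_derivative partial_deriv i f p) (at (p i))"
  using assms unfolding partial_deriv_def
  by (simp add: DERIV_deriv_iff_real_differentiable)

lemma Ck_on_add:
  assumes V: "openin (Euclidean_space n) V"
  shows "Ck_on n k V f \<Longrightarrow> Ck_on n k V g \<Longrightarrow> Ck_on n k V (\<lambda>p. f p + g p)"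
proof (induction k arbitrary: f g)
  case 0
  then show ?case by (simp add: continuous_map_Euclidean_subtopology[OF V] continuous_on_add)
next
  case (Suc k)
  have "partial_deriv i (\<lambda>p. f p + g p) p = partial_deriv i f p + partial_deriv i g p"
    if "i < n" "p \<in> V" for i p
  proof -
    have "((\<lambda>t. f (p(i := t)) + g (p(i := t))) has_field_derivative (partial_deriv i f p + partial_deriv i g p)) (at (p i))"
      using Suc.prems that by (intro DERIV_add has_partial_deriv) auto
    then show ?thesis by (simp add: partial_deriv_def DERIV_imp_deriv)
  qed
  note pd = this
  have "Ck_on n k V (partial_deriv i (\<lambda>p. f p + g p))" if "i < n" for i
  proof (rule Ck_on_cong[OF V])
    show "partial_deriv i f p + partial_deriv i g p = partial_deriv i (\<lambda>p. f p + g p) p" if "p \<in> V" for p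
      using pd[OF \<open>i < n\<close> that] by simp
    show "Ck_on n k V (\<lambda>p. partial_deriv i f p + partial_deriv i g p)"
      using Suc.prems that by (intro Suc.IH) simp_all
  qed
  with Suc.prems show ?case
    by (simp add: continuous_map_Euclidean_subtopology[OF V] continuous_on_add)
qed

lemma Ck_on_mult:
  assumes V: "openin (Euclidean_space n) V"
  shows "Ck_on n k V f \<Longrightarrow> Ck_on n k V g \<Longrightarrow> Ck_on n k V (\<lambda>p. f p * g p)"
proof (induction k arbitrary: f g)
  case 0
  then show ?case by (simp add: continuous_map_Euclidean_subtopology[OF V] continuous_on_mult)
next
  case (Suc k)
  have "partial_deriv i (\<lambda>p. f p * g p) p = partial_deriv i f p * g p + partial_deriv i g p * f p"
    if "i < n" "p \<in> V" for i p
  proof -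
    have "((\<lambda>t. f (p(i := t)) * g (p(i := t))) has_field_derivative
        (partial_deriv i f p * g (p(i := p i)) + partial_deriv i g p * f (p(i := p i)))) (at (p i))"
      using Suc.prems that by (intro DERIV_mult has_partial_deriv) auto
    then show ?thesis by (simp add: partial_deriv_def DERIV_imp_deriv)
  qed
  note pd = this
  have fg: "Ck_on n k V f" "Ck_on n k V g"
    using Suc.prems Ck_on_Suc_imp by blast+
  have "Ck_on n k V (partial_deriv i (\<lambda>p. f p * g p))" if "i < n" for i
  proof (rule Ck_on_cong[OF V])
    show "partial_deriv i f p * g p + partial_deriv i g p * f p = partial_deriv i (\<lambda>p. f p * g p) p"
      if "p \<in> V" for p
      using pd[OF \<open>i < n\<close> that] by simp
    have "Ck_on n k V (partial_deriv i f)" "Ck_on n k V (partial_deriv i g)"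
      using Suc.prems that by simp_all
    then show "Ck_on n k V (\<lambda>p. partial_deriv i f p * g p + partial_deriv i g p * f p)"
      by (intro Ck_on_add[OF V] Suc.IH fg)
  qed
  with Suc.prems show ?case
    by (simp add: continuous_map_Euclidean_subtopology[OF V] continuous_on_mult)
qed

lemma continuous_on_local_Euclidean:
  assumes V: "openin (Euclidean_space n) V"
    and loc: "\<And>p. p \<in> V \<Longrightarrow> \<exists>W. openin (Euclidean_space n) W \<and> p \<in> W \<and> W \<subseteq> V \<and> continuous_on W f"
  shows "continuous_on V f"
  unfolding continuous_on_eq_continuous_within
proof
  fix p assume "p \<in> V"
  then obtain W where W: "openin (Euclidean_space n) W" "p \<in> W" "W \<subseteq> V" "continuous_on W f"
    using loc by blast
  have *: "Euclidean_space n = top_of_set {p. \<forall>i\<ge>n. p i = 0}"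
    by (simp add: Euclidean_space_def euclidean_product_topology)
  obtain T where T: "open T" "W = {p. \<forall>i\<ge>n. p i = 0} \<inter> T"
    using W(1) unfolding * openin_open by blast
  have "V \<subseteq> {p. \<forall>i\<ge>n. p i = 0}"
    using openin_subset[OF V] by (simp add: topspace_Euclidean_space)
  with T W have "at p within V = at p within W"
    by (intro at_within_nhd[of p T]) auto
  with W show "continuous (at p within V) f"
    by (simp add: continuous_on_eq_continuous_within)
qed

lemma Ck_on_local:
  assumes V: "openin (Euclidean_space n) V"
    and loc: "\<And>p. p \<in> V \<Longrightarrow> \<exists>W. openin (Euclidean_space n) W \<and> p \<in> W \<and> W \<subseteq> V \<and> Ck_on n k W f"
  shows "Ck_on n k V f"
  using loc
proof (induction k arbitrary: f)
  case 0
  have "continuous_on V f"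
  proof (rule continuous_on_local_Euclidean[OF V])
    fix p assume "p \<in> V"
    from 0[OF this] obtain W where W: "openin (Euclidean_space n) W" "p \<in> W" "W \<subseteq> V" "Ck_on n 0 W f"
      by blast
    show "\<exists>W. openin (Euclidean_space n) W \<and> p \<in> W \<and> W \<subseteq> V \<and> continuous_on W f"
      using W(1-3) Ck_on_imp_continuous[OF W(4,1)] by blast
  qed
  then show ?case by (simp add: continuous_map_Euclidean_subtopology[OF V])
next
  case (Suc k)
  have ex: "\<exists>W. openin (Euclidean_space n) W \<and> p \<in> W \<and> W \<subseteq> V \<and> continuous_on W f \<and>
      (\<forall>i<n. (\<lambda>t. f (p(i := t))) differentiable (at (p i)) \<and> Ck_on n k W (partial_deriv i f))"
    if "p \<in> V" for p
  proof -
    from Suc.prems[OF that] obtain W where W: "openin (Euclidean_space n) W" "p \<in> W" "W \<subseteq> V"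
      "Ck_on n (Suc k) W f" by blast
    show ?thesis
    proof (intro exI[of _ W] conjI allI impI W(1-3))
      show "continuous_on W f" by (rule Ck_on_imp_continuous[OF W(4,1)])
      fix i assume "i < n"
      with W(2,4) show "(\<lambda>t. f (p(i := t))) differentiable (at (p i))" "Ck_on n k W (partial_deriv i f)"
        by simp_all
    qed
  qed
  have "continuous_on V f"
  proof (rule continuous_on_local_Euclidean[OF V])
    fix p assume "p \<in> V"
    from ex[OF this] show "\<exists>W. openin (Euclidean_space n) W \<and> p \<in> W \<and> W \<subseteq> V \<and> continuous_on W f"
      by (elim exE conjE) (intro exI conjI)
  qed
  moreover have "Ck_on n k V (partial_deriv i f)" if "i < n" for i
  proof (rule Suc.IH)
    fix p assume "p \<in> V"
    from ex[OF this] obtain W where W: "openin (Euclidean_space n) W" "p \<in> W" "W \<subseteq> V"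
      "\<forall>i<n. (\<lambda>t. f (p(i := t))) differentiable (at (p i)) \<and> Ck_on n k W (partial_deriv i f)"
      by (elim exE conjE) (rule that)
    from W(1-3) W(4)[rule_format, OF \<open>i < n\<close>]
    show "\<exists>W. openin (Euclidean_space n) W \<and> p \<in> W \<and> W \<subseteq> V \<and> Ck_on n k W (partial_deriv i f)"
      by (intro exI[of _ W]) simp
  qed
  moreover have "(\<lambda>t. f (p(i := t))) differentiable (at (p i))" if "i < n" "p \<in> V" for i p
    using ex[OF that(2)] that(1) by (elim exE conjE) simp
  ultimately show ?case by (simp add: continuous_map_Euclidean_subtopology[OF V])
qed

lemma Ck_on_subset:
  assumes V: "openin (Euclidean_space n) V" and W: "openin (Euclidean_space n) W" "W \<subseteq> V"
  shows "Ck_on n k V f \<Longrightarrow> Ck_on n k W f"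
proof (induction k arbitrary: f)
  case 0
  then show ?case
    using assms continuous_on_subset by (auto simp: continuous_map_Euclidean_subtopology)
next
  case (Suc k)
  have "continuous_on W f"
    using Suc.prems assms continuous_on_subset by (auto simp: continuous_map_Euclidean_subtopology)
  with Suc show ?case using W by (auto simp: continuous_map_Euclidean_subtopology)
qed

lemma openin_chart_image:
  assumes "smooth_manifold M" "(U, c) \<in> charts M" "open W"
  shows "openin (Euclidean_space (mdim M)) (c ` (U \<inter> W))"
proof -
  have o: "openin (Euclidean_space (mdim M)) (c ` U)"
    and h: "homeomorphic_map (top_of_set U) (subtopology (Euclidean_space (mdim M)) (c ` U)) c"
    using assms(1,2) unfolding smooth_manifold_def by fast+
  have "openin (top_of_set U) (U \<inter> W)"
    using assms(3) by (simp add: openin_open_Int)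
  then have "openin (subtopology (Euclidean_space (mdim M)) (c ` U)) (c ` (U \<inter> W))"
    using h homeomorphic_imp_open_map open_map_def by blast
  then show ?thesis
    using o openin_trans_full by blast
qed

lemma chart_inj:
  assumes "smooth_manifold M" "(U, c) \<in> charts M"
  shows "inj_on c U"
proof -
  have "homeomorphic_map (top_of_set U) (subtopology (Euclidean_space (mdim M)) (c ` U)) c"
    using assms(1,2) unfolding smooth_manifold_def by fast
  then show ?thesis using homeomorphic_imp_injective_map by fastforce
qed

lemma smooth_fun_on_add:
  "smooth_manifold M \<Longrightarrow> open W \<Longrightarrow> smooth_fun_on M W f \<Longrightarrow> smooth_fun_on M W g \<Longrightarrow>
    smooth_fun_on M W (\<lambda>x. f x + g x)"
  unfolding smooth_fun_on_def smooth_on_Rn_def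
  using openin_chart_image by (auto intro!: Ck_on_add)

lemma smooth_fun_on_mult:
  "smooth_manifold M \<Longrightarrow> open W \<Longrightarrow> smooth_fun_on M W f \<Longrightarrow> smooth_fun_on M W g \<Longrightarrow>
    smooth_fun_on M W (\<lambda>x. f x * g x)"
  unfolding smooth_fun_on_def smooth_on_Rn_def
  using openin_chart_image by (auto intro!: Ck_on_mult)

lemma smooth_fun_on_const: "smooth_manifold M \<Longrightarrow> open W \<Longrightarrow> smooth_fun_on M W (\<lambda>x. a)"
  unfolding smooth_fun_on_def smooth_on_Rn_def
  using openin_chart_image by (auto intro!: Ck_on_const)

lemma smooth_fun_on_sum:
  assumes "smooth_manifold M" "open W" "finite I" "\<And>i. i \<in> I \<Longrightarrow> smooth_fun_on M W (f i)"
  shows "smooth_fun_on M W (\<lambda>x. \<Sum>i\<in>I. f i x)"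
  using assms(3,4)
  by (induction I rule: finite_induct)
     (simp_all add: smooth_fun_on_add smooth_fun_on_const assms(1,2))

lemma smooth_fun_on_cong:
  assumes "smooth_manifold M" "open W" "smooth_fun_on M W f" "\<And>x. x \<in> W \<Longrightarrow> f x = g x"
  shows "smooth_fun_on M W g"
  unfolding smooth_fun_on_def smooth_on_Rn_def
proof (clarify)
  fix U c k assume c: "(U, c) \<in> charts M"
  show "Ck_on (mdim M) k (c ` (U \<inter> W)) (\<lambda>p. g (inv_into U c p))"
  proof (rule Ck_on_cong[OF openin_chart_image[OF assms(1) c assms(2)]])
    show "Ck_on (mdim M) k (c ` (U \<inter> W)) (\<lambda>p. f (inv_into U c p))"
      using assms(3) c unfolding smooth_fun_on_def smooth_on_Rn_def by blast
    show "f (inv_into U c q) = g (inv_into U c q)" if "q \<in> c ` (U \<inter> W)" for q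
      using that chart_inj[OF assms(1) c] assms(4) by (auto simp: inv_into_f_f)
  qed
qed

lemma smooth_fun_local:
  assumes M: "smooth_manifold M" and loc: "\<And>x. \<exists>W. open W \<and> x \<in> W \<and> smooth_fun_on M W f"
  shows "smooth_fun M f"
  unfolding smooth_fun_on_def smooth_on_Rn_def
proof (clarify)
  fix U c k assume c: "(U, c) \<in> charts M"
  show "Ck_on (mdim M) k (c ` (U \<inter> UNIV)) (\<lambda>p. f (inv_into U c p))"
  proof (rule Ck_on_local[OF openin_chart_image[OF M c open_UNIV]])
    fix p assume "p \<in> c ` (U \<inter> UNIV)"
    then obtain x where x: "x \<in> U" "p = c x" by auto
    obtain W where W: "open W" "x \<in> W" "smooth_fun_on M W f" using loc by blast
    then have "Ck_on (mdim M) k (c ` (U \<inter> W)) (\<lambda>p. f (inv_into U c p))"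
      using c unfolding smooth_fun_on_def smooth_on_Rn_def by blast
    then show "\<exists>W. openin (Euclidean_space (mdim M)) W \<and> p \<in> W \<and> W \<subseteq> c ` (U \<inter> UNIV) \<and>
        Ck_on (mdim M) k W (\<lambda>p. f (inv_into U c p))"
      using openin_chart_image[OF M c W(1)] x W(2) by blast
  qed
qed

lemma vector_bundleD:
  assumes "vector_bundle E"
  shows "smooth_manifold E" "subspace (fibre E x)" "\<exists>U e. (U, e) \<in> frames E \<and> x \<in> U"
    and "(U, e) \<in> frames E \<Longrightarrow> open U"
    and "(U, e) \<in> frames E \<Longrightarrow> x \<in> U \<Longrightarrow> inj_on (\<lambda>i. e i x) {..<rk E}"
    and "(U, e) \<in> frames E \<Longrightarrow> x \<in> U \<Longrightarrow> independent ((\<lambda>i. e i x) ` {..<rk E})"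
    and "(U, e) \<in> frames E \<Longrightarrow> x \<in> U \<Longrightarrow> span ((\<lambda>i. e i x) ` {..<rk E}) = fibre E x"
proof -
  note d = assms[unfolded vector_bundle_def]
  show "smooth_manifold E" "subspace (fibre E x)" using d by simp_all
  have "x \<in> (\<Union>(U, e)\<in>frames E. U)" using d by simp
  then show "\<exists>U e. (U, e) \<in> frames E \<and> x \<in> U" by auto
  assume e: "(U, e) \<in> frames E"
  have *: "open U \<and> (\<forall>x\<in>U. inj_on (\<lambda>i. e i x) {..<rk E} \<and>
               independent ((\<lambda>i. e i x) ` {..<rk E}) \<and>
               span ((\<lambda>i. e i x) ` {..<rk E}) = fibre E x)"
    using d e by (elim conjE) (drule (1) bspec, simp)
  then show "open U" by simp
  assume "x \<in> U"
  with * show "inj_on (\<lambda>i. e i x) {..<rk E}" "independent ((\<lambda>i. e i x) ` {..<rk E})"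
    "span ((\<lambda>i. e i x) ` {..<rk E}) = fibre E x" by simp_all
qed

lemma frame_expansion:
  assumes E: "vector_bundle E" and e: "(U, e) \<in> frames E" "x \<in> U" and v: "v \<in> fibre E x"
  shows "v = (\<Sum>i<rk E. coframe E e x i v *\<^sub>R e i x)"
proof -
  have b: "inj_on (\<lambda>i. e i x) {..<rk E}" "independent ((\<lambda>i. e i x) ` {..<rk E})"
    "span ((\<lambda>i. e i x) ` {..<rk E}) = fibre E x"
    using vector_bundleD(5-7)[OF E e] by simp_all
  have "v = (\<Sum>b\<in>(\<lambda>i. e i x) ` {..<rk E}. representation ((\<lambda>i. e i x) ` {..<rk E}) v b *\<^sub>R b)"
    using real_vector.sum_representation_eq[OF b(2)] v b(3) by simp
  also have "\<dots> = (\<Sum>i<rk E. coframe E e x i v *\<^sub>R e i x)"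
    using sum.reindex[OF b(1)] by (simp add: coframe_def)
  finally show ?thesis .
qed

lemma frame_in_fibre:
  "vector_bundle E \<Longrightarrow> (U, e) \<in> frames E \<Longrightarrow> x \<in> U \<Longrightarrow> i < rk E \<Longrightarrow> e i x \<in> fibre E x"
  using span_base[of "e i x" "(\<lambda>i. e i x) ` {..<rk E}"] vector_bundleD(7)[of E U e x] by simp

lemma fibre_subspace: "vector_bundle E \<Longrightarrow> subspace (fibre E x)"
  by (rule vector_bundleD(2))

lemma coframe_dual:
  assumes E: "vector_bundle E" and e: "(U, e) \<in> frames E" "x \<in> U"
  shows "coframe E e x i \<in> dual E x"
proof -
  have b: "independent ((\<lambda>i. e i x) ` {..<rk E})" "span ((\<lambda>i. e i x) ` {..<rk E}) = fibre E x"
    using vector_bundleD(5-7)[OF E e] by simp_all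
  show ?thesis
    unfolding dual_def
  proof (intro CollectI conjI allI ballI impI)
    fix u v assume "u \<in> fibre E x" "v \<in> fibre E x"
    then show "coframe E e x i (u + v) = coframe E e x i u + coframe E e x i v"
      unfolding coframe_def using b by (simp add: real_vector.representation_add)
  next
    fix c u assume "u \<in> fibre E x"
    then show "coframe E e x i (c *\<^sub>R u) = c * coframe E e x i u"
      unfolding coframe_def using b by (simp add: real_vector.representation_scale)
  next
    fix v assume "v \<notin> fibre E x"
    then show "coframe E e x i v = 0"
      unfolding coframe_def using b by (simp add: real_vector.representation_def)
  qed
qed

lemma dual_sum:
  assumes "vector_bundle E" "\<phi> \<in> dual E x" "finite I" "\<And>i. i \<in> I \<Longrightarrow> u i \<in> fibre E x"
  shows "\<phi> (\<Sum>i\<in>I. u i) = (\<Sum>i\<in>I. \<phi> (u i))"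
  using assms(3,4)
proof (induction I rule: finite_induct)
  case empty
  have "\<phi> (0 *\<^sub>R 0) = 0 * \<phi> 0"
    using assms(2) subspace_0[OF fibre_subspace[OF assms(1)]] unfolding dual_def by blast
  then show ?case by simp
next
  case (insert i I)
  have "(\<Sum>i\<in>I. u i) \<in> fibre E x"
    using insert by (intro subspace_sum[OF fibre_subspace[OF assms(1)]]) auto
  then show ?case using insert assms(2) by (simp add: dual_def)
qed

lemma dual_separates:
  assumes E: "vector_bundle E" and "u \<in> fibre E x" "v \<in> fibre E x" "\<And>\<phi>. \<phi> \<in> dual E x \<Longrightarrow> \<phi> u = \<phi> v"
  shows "u = v"
proof -
  obtain U e where e: "(U, e) \<in> frames E" "x \<in> U"
    using vector_bundleD(3)[OF E] by blast
  have "u = (\<Sum>i<rk E. coframe E e x i u *\<^sub>R e i x)"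
    by (rule frame_expansion[OF E e assms(2)])
  also have "\<dots> = (\<Sum>i<rk E. coframe E e x i v *\<^sub>R e i x)"
    using assms(4)[OF coframe_dual[OF E e]] by simp
  also have "\<dots> = v"
    by (rule frame_expansion[OF E e assms(3), symmetric])
  finally show ?thesis .
qed

lemma smooth_pairing:
  assumes E: "vector_bundle E" and \<alpha>: "\<alpha> \<in> dual_sections E" and X: "X \<in> sections E"
  shows "smooth_fun E (\<lambda>x. \<alpha> x (X x))"
proof -
  have M: "smooth_manifold E" using E by (simp add: vector_bundle_def)
  show ?thesis
  proof (rule smooth_fun_local[OF M])
    fix x
    obtain U e where e: "(U, e) \<in> frames E" "x \<in> U"
      using vector_bundleD(3)[OF E] by blast
    have U: "open U" by (rule vector_bundleD(4)[OF E e(1)])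
    have "smooth_fun_on E U (\<lambda>x. \<Sum>i<rk E. coframe E e x i (X x) * \<alpha> x (e i x))"
      using \<alpha> X e(1) unfolding sections_def dual_sections_def
      by (intro smooth_fun_on_sum smooth_fun_on_mult M U) auto
    moreover have "(\<Sum>i<rk E. coframe E e y i (X y) * \<alpha> y (e i y)) = \<alpha> y (X y)" if y: "y \<in> U" for y
    proof -
      have a: "\<alpha> y \<in> dual E y" and Xy: "X y \<in> fibre E y"
        using \<alpha> X by (auto simp: dual_sections_def sections_def)
      have f: "e i y \<in> fibre E y" if "i < rk E" for i
        using frame_in_fibre[OF E e(1) y that] .
      have "\<alpha> y (X y) = \<alpha> y (\<Sum>i<rk E. coframe E e y i (X y) *\<^sub>R e i y)"
        using arg_cong[OF frame_expansion[OF E e(1) y Xy], of "\<alpha> y"] .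
      also have "\<dots> = (\<Sum>i<rk E. \<alpha> y (coframe E e y i (X y) *\<^sub>R e i y))"
        using f by (intro dual_sum[OF E a]) (auto intro: subspace_scale fibre_subspace[OF E])
      also have "\<dots> = (\<Sum>i<rk E. coframe E e y i (X y) * \<alpha> y (e i y))"
        using a f by (intro sum.cong) (auto simp: dual_def)
      finally show ?thesis by simp
    qed
    ultimately have "smooth_fun_on E U (\<lambda>x. \<alpha> x (X x))"
      by (rule smooth_fun_on_cong[OF M U])
    with U e(2) show "\<exists>W. open W \<and> x \<in> W \<and> smooth_fun_on E W (\<lambda>x. \<alpha> x (X x))"
      by blast
  qed
qed

lemma sections_add:
  assumes E: "vector_bundle E" and X: "X \<in> sections E" and Y: "Y \<in> sections E"
  shows "(\<lambda>x. X x + Y x) \<in> sections E"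
  unfolding sections_def
proof (intro CollectI conjI allI ballI; clarify?)
  show "X x + Y x \<in> fibre E x" for x
    using X Y by (auto simp: sections_def intro: subspace_add fibre_subspace[OF E])
  fix U e i assume e: "(U, e) \<in> frames E" and i: "i < rk E"
  have M: "smooth_manifold E" and U: "open U" using vector_bundleD(1,4)[OF E] e by simp_all
  have "smooth_fun_on E U (\<lambda>x. coframe E e x i (X x) + coframe E e x i (Y x))"
    using X Y e i unfolding sections_def by (intro smooth_fun_on_add M U) auto
  then show "smooth_fun_on E U (\<lambda>x. coframe E e x i (X x + Y x))"
    by (rule smooth_fun_on_cong[OF M U])
       (use coframe_dual[OF E e] X Y in \<open>auto simp: dual_def sections_def\<close>)
qed

lemma smooth_fun_on_subset:
  assumes "smooth_manifold M" "open W" "smooth_fun M f"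
  shows "smooth_fun_on M W f"
  unfolding smooth_fun_on_def smooth_on_Rn_def
proof clarify
  fix U c k assume c: "(U, c) \<in> charts M"
  show "Ck_on (mdim M) k (c ` (U \<inter> W)) (\<lambda>p. f (inv_into U c p))"
    using assms(3) c unfolding smooth_fun_on_def smooth_on_Rn_def
    by (intro Ck_on_subset[OF openin_chart_image[OF assms(1) c open_UNIV]
          openin_chart_image[OF assms(1) c assms(2)]]) auto
qed

lemma sections_scale:
  assumes E: "vector_bundle E" and f: "smooth_fun E f" and X: "X \<in> sections E"
  shows "(\<lambda>x. f x *\<^sub>R X x) \<in> sections E"
  unfolding sections_def
proof (intro CollectI conjI allI ballI; clarify?)
  show "f x *\<^sub>R X x \<in> fibre E x" for x
    using X by (auto simp: sections_def intro: subspace_scale fibre_subspace[OF E])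
  fix U e i assume e: "(U, e) \<in> frames E" and i: "i < rk E"
  have M: "smooth_manifold E" and U: "open U" using vector_bundleD(1,4)[OF E] e by simp_all
  have "smooth_fun_on E U (\<lambda>x. f x * coframe E e x i (X x))"
  proof (rule smooth_fun_on_mult[OF M U smooth_fun_on_subset[OF M U f]])
    show "smooth_fun_on E U (\<lambda>x. coframe E e x i (X x))"
      using X e i unfolding sections_def by auto
  qed
  then show "smooth_fun_on E U (\<lambda>x. coframe E e x i (f x *\<^sub>R X x))"
    by (rule smooth_fun_on_cong[OF M U])
       (use coframe_dual[OF E e] X in \<open>auto simp: dual_def sections_def\<close>)
qed

lemma lie_algebroidD:
  assumes "lie_algebroid A"
  shows "vector_bundle A"
    and "u \<in> fibre A x \<Longrightarrow> anchor A x u \<in> tangent_space A x"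
    and "u \<in> fibre A x \<Longrightarrow> v \<in> fibre A x \<Longrightarrow> smooth_fun A f \<Longrightarrow>
      anchor A x (u + v) f = anchor A x u f + anchor A x v f"
    and "u \<in> fibre A x \<Longrightarrow> smooth_fun A f \<Longrightarrow> anchor A x (c *\<^sub>R u) f = c * anchor A x u f"
    and "X \<in> sections A \<Longrightarrow> smooth_fun A f \<Longrightarrow> smooth_fun A (anchor_deriv A X f)"
    and "X \<in> sections A \<Longrightarrow> Y \<in> sections A \<Longrightarrow> bracket A X Y \<in> sections A"
    and "X \<in> sections A \<Longrightarrow> Y \<in> sections A \<Longrightarrow> Z \<in> sections A \<Longrightarrow>
      bracket A X (\<lambda>y. Y y + Z y) x = bracket A X Y x + bracket A X Z x"
    and "X \<in> sections A \<Longrightarrow> Y \<in> sections A \<Longrightarrow> bracket A X Y x = - bracket A Y X x"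
    and "X \<in> sections A \<Longrightarrow> Y \<in> sections A \<Longrightarrow> smooth_fun A f \<Longrightarrow>
      bracket A X (\<lambda>y. f y *\<^sub>R Y y) x = f x *\<^sub>R bracket A X Y x + anchor_deriv A X f x *\<^sub>R Y x"
proof -
  note d = assms[unfolded lie_algebroid_def]
  note d2 = d[THEN conjunct2]
  note d3 = d2[THEN conjunct2]
  note d4 = d3[THEN conjunct2]
  note d5 = d4[THEN conjunct2]
  note d6 = d5[THEN conjunct2]
  show "vector_bundle A" by (rule d[THEN conjunct1])
  show "u \<in> fibre A x \<Longrightarrow> anchor A x u \<in> tangent_space A x"
    using d2[THEN conjunct1] by blast
  show "u \<in> fibre A x \<Longrightarrow> v \<in> fibre A x \<Longrightarrow> smooth_fun A f \<Longrightarrow>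
      anchor A x (u + v) f = anchor A x u f + anchor A x v f"
    "u \<in> fibre A x \<Longrightarrow> smooth_fun A f \<Longrightarrow> anchor A x (c *\<^sub>R u) f = c * anchor A x u f"
    using d3[THEN conjunct1] by blast+
  show "X \<in> sections A \<Longrightarrow> smooth_fun A f \<Longrightarrow> smooth_fun A (anchor_deriv A X f)"
    using d4[THEN conjunct1] by blast
  show "X \<in> sections A \<Longrightarrow> Y \<in> sections A \<Longrightarrow> bracket A X Y \<in> sections A"
    using d5[THEN conjunct1] by blast
  show "X \<in> sections A \<Longrightarrow> Y \<in> sections A \<Longrightarrow> Z \<in> sections A \<Longrightarrow>
      bracket A X (\<lambda>y. Y y + Z y) x = bracket A X Y x + bracket A X Z x"
    "X \<in> sections A \<Longrightarrow> Y \<in> sections A \<Longrightarrow> bracket A X Y x = - bracket A Y X x"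
    using d6[THEN conjunct1] by blast+
  show "X \<in> sections A \<Longrightarrow> Y \<in> sections A \<Longrightarrow> smooth_fun A f \<Longrightarrow>
      bracket A X (\<lambda>y. f y *\<^sub>R Y y) x = f x *\<^sub>R bracket A X Y x + anchor_deriv A X f x *\<^sub>R Y x"
    using d6[THEN conjunct2] by blast
qed

lemma lie_algebroid_imp:
  assumes "lie_algebroid A"
  shows "vector_bundle A" "smooth_manifold A"
  using lie_algebroidD(1)[OF assms] vector_bundleD(1) by simp_all

lemma sections_zero:
  assumes E: "vector_bundle E"
  shows "(\<lambda>x. 0) \<in> sections E"
  unfolding sections_def
proof (intro CollectI conjI allI ballI; clarify?)
  show "0 \<in> fibre E x" for x
    by (intro subspace_0 fibre_subspace[OF E])
  fix U e i assume e: "(U, e) \<in> frames E" and i: "i < rk E"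
  have M: "smooth_manifold E" and U: "open U" using vector_bundleD(1,4)[OF E] e by simp_all
  show "smooth_fun_on E U (\<lambda>x. coframe E e x i 0)"
    by (simp add: coframe_def real_vector.representation_zero smooth_fun_on_const M U)
qed

lemma sections_sum:
  assumes E: "vector_bundle E" and "finite I"
    and "\<And>k. k \<in> I \<Longrightarrow> smooth_fun E (f k)" "\<And>k. k \<in> I \<Longrightarrow> X k \<in> sections E"
  shows "(\<lambda>x. \<Sum>k\<in>I. f k x *\<^sub>R X k x) \<in> sections E"
  using assms(2-)
  by (induction I rule: finite_induct) (simp_all add: sections_zero sections_add sections_scale E)

lemma anchor_deriv_fun:
  assumes A: "lie_algebroid A" and X: "X \<in> sections A" and f: "smooth_fun A f" and g: "smooth_fun A g"
  shows "anchor_deriv A X (\<lambda>y. f y + g y) x = anchor_deriv A X f x + anchor_deriv A X g x"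
    and "anchor_deriv A X (\<lambda>y. c * f y) x = c * anchor_deriv A X f x"
    and "anchor_deriv A X (\<lambda>y. f y * g y) x = f x * anchor_deriv A X g x + g x * anchor_deriv A X f x"
proof -
  have "X x \<in> fibre A x" using X by (simp add: sections_def)
  then have "anchor A x (X x) \<in> tangent_space A x" by (rule lie_algebroidD(2)[OF A])
  then show "anchor_deriv A X (\<lambda>y. f y + g y) x = anchor_deriv A X f x + anchor_deriv A X g x"
    and "anchor_deriv A X (\<lambda>y. c * f y) x = c * anchor_deriv A X f x"
    and "anchor_deriv A X (\<lambda>y. f y * g y) x = f x * anchor_deriv A X g x + g x * anchor_deriv A X f x"
    using f g by (auto simp: tangent_space_def anchor_deriv_def)
qed

lemma smooth_fun_diff:
  "smooth_manifold M \<Longrightarrow> smooth_fun M f \<Longrightarrow> smooth_fun M g \<Longrightarrow> smooth_fun M (\<lambda>x. f x - g x)"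
  using smooth_fun_on_add[of M UNIV f "\<lambda>x. (-1) * g x"] smooth_fun_on_mult[of M UNIV "\<lambda>x. -1" g]
    smooth_fun_on_const[of M UNIV "-1"] by simp

lemma anchor_deriv_fun_diff:
  assumes A: "lie_algebroid A" and X: "X \<in> sections A" and f: "smooth_fun A f" and g: "smooth_fun A g"
  shows "anchor_deriv A X (\<lambda>y. f y - g y) x = anchor_deriv A X f x - anchor_deriv A X g x"
proof -
  have M: "smooth_manifold A" using lie_algebroid_imp[OF A] by blast
  have "smooth_fun A (\<lambda>y. (-1) * g y)"
    by (rule smooth_fun_on_mult[OF M open_UNIV smooth_fun_on_const[OF M open_UNIV] g])
  from anchor_deriv_fun(1)[OF A X f this, of x] anchor_deriv_fun(2)[OF A X g g, of "-1" x]
  show ?thesis by simp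
qed

lemma anchor_deriv_fun_sum:
  assumes A: "lie_algebroid A" and X: "X \<in> sections A" and "finite I"
    and "\<And>k. k \<in> I \<Longrightarrow> smooth_fun A (f k)"
  shows "anchor_deriv A X (\<lambda>y. \<Sum>k\<in>I. f k y) x = (\<Sum>k\<in>I. anchor_deriv A X (f k) x)"
  using assms(3,4)
proof (induction I rule: finite_induct)
  case empty
  have "smooth_fun A (\<lambda>y. 0)" by (rule smooth_fun_on_const[OF lie_algebroid_imp(2)[OF A] open_UNIV])
  from anchor_deriv_fun(2)[OF A X this this, of 0 x] show ?case by simp
next
  case (insert k I)
  then show ?case
    using smooth_fun_on_sum[of A UNIV I f] lie_algebroid_imp[OF A]
    by (simp add: anchor_deriv_fun(1)[OF A X])
qed

lemma anchor_deriv_sum: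
  assumes A: "lie_algebroid A" and f: "smooth_fun A f" and "finite I"
    and "\<And>k. k \<in> I \<Longrightarrow> X k x \<in> fibre A x"
    and "Z x = (\<Sum>k\<in>I. a k *\<^sub>R X k x)"
  shows "anchor_deriv A Z f x = (\<Sum>k\<in>I. a k * anchor_deriv A (X k) f x)"
proof -
  have s: "subspace (fibre A x)" using A by (simp add: lie_algebroid_imp fibre_subspace)
  have add: "anchor A x (u + v) f = anchor A x u f + anchor A x v f"
    and scale: "anchor A x (c *\<^sub>R u) f = c * anchor A x u f" if "u \<in> fibre A x" "v \<in> fibre A x" for u v c
    using lie_algebroidD(3,4)[OF A] f that by simp_all
  have "anchor A x (\<Sum>k\<in>I. a k *\<^sub>R X k x) f = (\<Sum>k\<in>I. a k * anchor A x (X k x) f)"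
    using assms(3,4)
  proof (induction I rule: finite_induct)
    case empty
    show ?case using scale[of 0 0 0] subspace_0[OF s] by simp
  next
    case (insert k I)
    have "(\<Sum>k\<in>I. a k *\<^sub>R X k x) \<in> fibre A x"
      using insert by (intro subspace_sum[OF s]) (auto intro: subspace_scale[OF s])
    with insert show ?case
      using add[of "a k *\<^sub>R X k x" "\<Sum>k\<in>I. a k *\<^sub>R X k x"] scale[of "X k x" "X k x" "a k"]
      by (simp add: subspace_scale[OF s])
  qed
  then show ?thesis using assms(5) by (simp add: anchor_deriv_def)
qed

lemma d_one_skew:
  assumes A: "lie_algebroid A" and "\<alpha> \<in> dual_sections A" "X \<in> sections A" "Y \<in> sections A"
  shows "d_one A \<alpha> X Y x = - d_one A \<alpha> Y X x"
proof -
  have a: "\<alpha> x \<in> dual A x" using assms by (simp add: dual_sections_def)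
  have b: "bracket A X Y x = (-1) *\<^sub>R bracket A Y X x"
    using lie_algebroidD(8)[OF A assms(3,4)] by simp
  have f: "bracket A Y X x \<in> fibre A x"
    using lie_algebroidD(6)[OF A assms(4,3)] by (simp add: sections_def)
  have "\<alpha> x ((-1) *\<^sub>R bracket A Y X x) = (-1) * \<alpha> x (bracket A Y X x)"
    using a f unfolding dual_def by blast
  with b have "\<alpha> x (bracket A X Y x) = - \<alpha> x (bracket A Y X x)"
    by simp
  then show ?thesis by (simp add: d_one_def)
qed

lemma d_one_sum:
  assumes A: "lie_algebroid A" and \<alpha>: "\<alpha> \<in> dual_sections A" and X: "X \<in> sections A" and I: "finite I"
    and f: "\<And>k. k \<in> I \<Longrightarrow> smooth_fun A (f k)" and Y: "\<And>k. k \<in> I \<Longrightarrow> Y k \<in> sections A"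
  shows "d_one A \<alpha> X (\<lambda>y. \<Sum>k\<in>I. f k y *\<^sub>R Y k y) x = (\<Sum>k\<in>I. f k x * d_one A \<alpha> X (Y k) x)"
proof -
  have E: "vector_bundle A" and M: "smooth_manifold A" using lie_algebroid_imp[OF A] .
  have a: "\<alpha> x \<in> dual A x" for x using \<alpha> by (simp add: dual_sections_def)
  have a2: "u \<in> fibre A x \<Longrightarrow> v \<in> fibre A x \<Longrightarrow> \<alpha> x (u + v) = \<alpha> x u + \<alpha> x v"
    "u \<in> fibre A x \<Longrightarrow> \<alpha> x (c *\<^sub>R u) = c * \<alpha> x u"
    for u v c x using a[of x] by (simp_all add: dual_def)
  have fib: "Z x \<in> fibre A x" if "Z \<in> sections A" for Z x using that by (simp add: sections_def)
  have br: "bracket A X Z \<in> sections A" if "Z \<in> sections A" for Z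
    by (rule lie_algebroidD(6)[OF A X that])
  have add: "d_one A \<alpha> X (\<lambda>y. Z y + W y) x = d_one A \<alpha> X Z x + d_one A \<alpha> X W x"
    if Z: "Z \<in> sections A" and W: "W \<in> sections A" for Z W
  proof -
    have "(\<lambda>y. \<alpha> y (Z y + W y)) = (\<lambda>y. \<alpha> y (Z y) + \<alpha> y (W y))"
      using a2(1)[OF fib[OF Z] fib[OF W]] by simp
    moreover have "bracket A X (\<lambda>y. Z y + W y) x = bracket A X Z x + bracket A X W x"
      by (rule lie_algebroidD(7)[OF A X Z W])
    moreover have "anchor_deriv A (\<lambda>y. Z y + W y) h x = anchor_deriv A Z h x + anchor_deriv A W h x"
      if "smooth_fun A h" for h
      unfolding anchor_deriv_def by (rule lie_algebroidD(3)[OF A fib[OF Z] fib[OF W] that])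
    ultimately show ?thesis
      using anchor_deriv_fun(1)[OF A X smooth_pairing[OF E \<alpha> Z] smooth_pairing[OF E \<alpha> W]]
        a2(1)[OF fib[OF br[OF Z]] fib[OF br[OF W]]]
      by (simp add: d_one_def smooth_pairing[OF E \<alpha> X])
  qed
  have scale: "d_one A \<alpha> X (\<lambda>y. h y *\<^sub>R Z y) x = h x * d_one A \<alpha> X Z x"
    if h: "smooth_fun A h" and Z: "Z \<in> sections A" for Z h
  proof -
    have "(\<lambda>y. \<alpha> y (h y *\<^sub>R Z y)) = (\<lambda>y. h y * \<alpha> y (Z y))"
      using a2(2)[OF fib[OF Z]] by simp
    moreover have "bracket A X (\<lambda>y. h y *\<^sub>R Z y) x = h x *\<^sub>R bracket A X Z x + anchor_deriv A X h x *\<^sub>R Z x"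
      by (rule lie_algebroidD(9)[OF A X Z h])
    moreover have "anchor_deriv A (\<lambda>y. h y *\<^sub>R Z y) k x = h x * anchor_deriv A Z k x"
      if "smooth_fun A k" for k
      unfolding anchor_deriv_def by (rule lie_algebroidD(4)[OF A fib[OF Z] that])
    moreover have "\<alpha> x (h x *\<^sub>R bracket A X Z x + anchor_deriv A X h x *\<^sub>R Z x) =
        h x * \<alpha> x (bracket A X Z x) + anchor_deriv A X h x * \<alpha> x (Z x)"
      using a2 fib[OF Z, of x] fib[OF br[OF Z], of x] by (simp add: subspace_scale[OF fibre_subspace[OF E]])
    ultimately show ?thesis
      using anchor_deriv_fun(3)[OF A X h smooth_pairing[OF E \<alpha> Z], of x]
      by (simp add: d_one_def smooth_pairing[OF E \<alpha> X] algebra_simps)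
  qed
  show ?thesis
    using I f Y
  proof (induction I rule: finite_induct)
    case empty
    show ?case using scale[of "\<lambda>_. 0" X] X M by (simp add: smooth_fun_on_const)
  next
    case (insert k I)
    then show ?case
      by (simp add: add scale sections_sum[OF E] sections_scale[OF E])
  qed
qed

text \<open>\<open>wedge_sum I X Y\<close> is the bivector field \<open>\<Sum>k\<in>I. X k \<and> Y k\<close>.\<close>

definition wedge_sum ::
  "'i set \<Rightarrow> ('i \<Rightarrow> 'm \<Rightarrow> 'v) \<Rightarrow> ('i \<Rightarrow> 'm \<Rightarrow> 'v) \<Rightarrow> ('m, 'v) tensor20" where
  "wedge_sum I X Y x \<phi> \<psi> = (\<Sum>k\<in>I. \<phi> (X k x) * \<psi> (Y k x) - \<phi> (Y k x) * \<psi> (X k x))"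

definition wedge_three ::
  "('m \<Rightarrow> 'v) \<Rightarrow> ('m \<Rightarrow> 'v) \<Rightarrow> ('m \<Rightarrow> 'v) \<Rightarrow>
     ('m \<Rightarrow> 'v \<Rightarrow> real) \<Rightarrow> ('m \<Rightarrow> 'v \<Rightarrow> real) \<Rightarrow> ('m \<Rightarrow> 'v \<Rightarrow> real) \<Rightarrow> 'm \<Rightarrow> real" where
  "wedge_three X Y Z \<alpha> \<beta> \<gamma> x =
     \<alpha> x (X x) * (\<beta> x (Y x) * \<gamma> x (Z x) - \<beta> x (Z x) * \<gamma> x (Y x))
     - \<alpha> x (Y x) * (\<beta> x (X x) * \<gamma> x (Z x) - \<beta> x (Z x) * \<gamma> x (X x))
     + \<alpha> x (Z x) * (\<beta> x (X x) * \<gamma> x (Y x) - \<beta> x (Y x) * \<gamma> x (X x))"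

definition schouten_term ::
  "('m, 'v, 'z) algebroid_scheme \<Rightarrow> ('m \<Rightarrow> 'v) \<Rightarrow> ('m \<Rightarrow> 'v) \<Rightarrow> ('m \<Rightarrow> 'v) \<Rightarrow> ('m \<Rightarrow> 'v) \<Rightarrow>
     ('m \<Rightarrow> 'v \<Rightarrow> real) \<Rightarrow> ('m \<Rightarrow> 'v \<Rightarrow> real) \<Rightarrow> ('m \<Rightarrow> 'v \<Rightarrow> real) \<Rightarrow> 'm \<Rightarrow> real" where
  "schouten_term A a b c d \<alpha> \<beta> \<gamma> x =
     \<alpha> x (a x) * anchor_deriv A b (\<lambda>y. \<beta> y (c y) * \<gamma> y (d y)) x
     + \<alpha> x (c x) * anchor_deriv A d (\<lambda>y. \<beta> y (a y) * \<gamma> y (b y)) x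
     - \<beta> x (a x) * \<gamma> x (c x) * d_one A \<alpha> b d x
     - \<beta> x (c x) * \<gamma> x (a x) * d_one A \<alpha> d b x"

lemma sharp_tensor_sum:
  assumes E: "vector_bundle E" and I: "finite I" and b: "\<And>k. k \<in> I \<Longrightarrow> b k \<in> sections E"
    and \<phi>: "\<phi> \<in> dual E x"
  shows "sharp E (\<lambda>x \<phi> \<psi>. \<Sum>k\<in>I. p k * (\<phi> (a k x) * \<psi> (b k x))) x \<phi> =
    (\<Sum>k\<in>I. (p k * \<phi> (a k x)) *\<^sub>R b k x)" (is "sharp E ?P x \<phi> = ?v")
proof -
  have bf: "(p k * \<phi> (a k x)) *\<^sub>R b k x \<in> fibre E x" "b k x \<in> fibre E x" if "k \<in> I" for k
    using b[OF that] by (auto simp: sections_def intro: subspace_scale fibre_subspace[OF E])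
  have v: "?v \<in> fibre E x"
    by (rule subspace_sum[OF fibre_subspace[OF E]]) (rule bf)
  have ev: "\<psi> ?v = ?P x \<phi> \<psi>" if \<psi>: "\<psi> \<in> dual E x" for \<psi>
  proof -
    have "\<psi> ?v = (\<Sum>k\<in>I. \<psi> ((p k * \<phi> (a k x)) *\<^sub>R b k x))"
      by (rule dual_sum[OF E \<psi> I]) (rule bf)
    also have "\<dots> = ?P x \<phi> \<psi>"
    proof (rule sum.cong[OF refl])
      fix k assume "k \<in> I"
      with \<psi> bf(2) have "\<psi> ((p k * \<phi> (a k x)) *\<^sub>R b k x) = (p k * \<phi> (a k x)) * \<psi> (b k x)"
        unfolding dual_def by blast
      then show "\<psi> ((p k * \<phi> (a k x)) *\<^sub>R b k x) = p k * (\<phi> (a k x) * \<psi> (b k x))"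
        by simp
    qed
    finally show ?thesis .
  qed
  show ?thesis
    unfolding sharp_def
  proof (rule the_equality)
    show "?v \<in> fibre E x \<and> (\<forall>\<psi>\<in>dual E x. \<psi> ?v = ?P x \<phi> \<psi>)"
      by (intro conjI ballI v ev)
    fix w assume w: "w \<in> fibre E x \<and> (\<forall>\<psi>\<in>dual E x. \<psi> w = ?P x \<phi> \<psi>)"
    show "w = ?v"
    proof (rule dual_separates[OF E w[THEN conjunct1] v])
      fix \<psi> assume "\<psi> \<in> dual E x"
      then show "\<psi> w = \<psi> ?v" using w[THEN conjunct2] by (simp only: ev)
    qed
  qed
qed

lemma schouten_tensor_sum:
  fixes A :: "('m::{t2_space,second_countable_topology}, 'v::real_vector, 'z) algebroid_scheme"
    and p :: "'i \<Rightarrow> real" and q :: "'j \<Rightarrow> real"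
  assumes A: "lie_algebroid A" and I: "finite I" and J: "finite J"
    and a: "\<And>k. k \<in> I \<Longrightarrow> a k \<in> sections A" and b: "\<And>k. k \<in> I \<Longrightarrow> b k \<in> sections A"
    and c: "\<And>l. l \<in> J \<Longrightarrow> c l \<in> sections A" and d: "\<And>l. l \<in> J \<Longrightarrow> d l \<in> sections A"
    and \<alpha>: "\<alpha> \<in> dual_sections A" and \<beta>: "\<beta> \<in> dual_sections A" and \<gamma>: "\<gamma> \<in> dual_sections A"
  defines "P \<equiv> \<lambda>x \<phi> \<psi>. \<Sum>k\<in>I. p k * (\<phi> (a k x) * \<psi> (b k x))"
    and "Q \<equiv> \<lambda>x \<phi> \<psi>. \<Sum>l\<in>J. q l * (\<phi> (c l x) * \<psi> (d l x))"
  shows "schouten A P Q \<alpha> \<beta> \<gamma> x = (\<Sum>k\<in>I. \<Sum>l\<in>J. p k * q l *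
     (schouten_term A (a k) (b k) (c l) (d l) \<alpha> \<beta> \<gamma> x
      + schouten_term A (a k) (b k) (c l) (d l) \<beta> \<gamma> \<alpha> x
      + schouten_term A (a k) (b k) (c l) (d l) \<gamma> \<alpha> \<beta> x))"
proof -
  have E: "vector_bundle A" and M: "smooth_manifold A" using lie_algebroid_imp[OF A] .
  note sm = smooth_fun_on_mult[OF M open_UNIV smooth_fun_on_const[OF M open_UNIV]]
  have main: "anchor_deriv A (\<lambda>y. sharp A P y (\<alpha> y)) (\<lambda>y. Q y (\<beta> y) (\<gamma> y)) x
      + anchor_deriv A (\<lambda>y. sharp A Q y (\<alpha> y)) (\<lambda>y. P y (\<beta> y) (\<gamma> y)) x
      - d_one A \<alpha> (\<lambda>y. sharp A P y (\<beta> y)) (\<lambda>y. sharp A Q y (\<gamma> y)) x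
      - d_one A \<alpha> (\<lambda>y. sharp A Q y (\<beta> y)) (\<lambda>y. sharp A P y (\<gamma> y)) x
    = (\<Sum>k\<in>I. \<Sum>l\<in>J. p k * q l * schouten_term A (a k) (b k) (c l) (d l) \<alpha> \<beta> \<gamma> x)"
    if \<alpha>: "\<alpha> \<in> dual_sections A" and \<beta>: "\<beta> \<in> dual_sections A" and \<gamma>: "\<gamma> \<in> dual_sections A" for \<alpha> \<beta> \<gamma>
  proof -
    have sP: "(\<lambda>y. sharp A P y (\<kappa> y)) = (\<lambda>y. \<Sum>k\<in>I. (p k * \<kappa> y (a k y)) *\<^sub>R b k y)"
      and sQ: "(\<lambda>y. sharp A Q y (\<kappa> y)) = (\<lambda>y. \<Sum>l\<in>J. (q l * \<kappa> y (c l y)) *\<^sub>R d l y)"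
      if "\<kappa> \<in> dual_sections A" for \<kappa>
      using sharp_tensor_sum[OF E I b] sharp_tensor_sum[OF E J d] that
      unfolding P_def Q_def by (auto simp: dual_sections_def)
    have pr: "smooth_fun A (\<lambda>y. r * \<kappa> y (Z y))" if "\<kappa> \<in> dual_sections A" "Z \<in> sections A" for r \<kappa> Z
      by (rule sm[OF smooth_pairing[OF E that]])
    have pp: "smooth_fun A (\<lambda>y. \<beta> y (Z y) * \<gamma> y (W y))" if "Z \<in> sections A" "W \<in> sections A" for Z W
      by (rule smooth_fun_on_mult[OF M open_UNIV smooth_pairing[OF E \<beta> that(1)] smooth_pairing[OF E \<gamma> that(2)]])
    have secP: "(\<lambda>y. \<Sum>k\<in>I. (p k * \<kappa> y (a k y)) *\<^sub>R b k y) \<in> sections A" if "\<kappa> \<in> dual_sections A" for \<kappa>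
      by (rule sections_sum[OF E I pr[OF that a] b])
    have secQ: "(\<lambda>y. \<Sum>l\<in>J. (q l * \<kappa> y (c l y)) *\<^sub>R d l y) \<in> sections A" if "\<kappa> \<in> dual_sections A" for \<kappa>
      by (rule sections_sum[OF E J pr[OF that c] d])
    have fP: "smooth_fun A (\<lambda>y. P y (\<beta> y) (\<gamma> y))"
      unfolding P_def by (rule smooth_fun_on_sum[OF M open_UNIV I sm[OF pp[OF a b]]])
    have fQ: "smooth_fun A (\<lambda>y. Q y (\<beta> y) (\<gamma> y))"
      unfolding Q_def by (rule smooth_fun_on_sum[OF M open_UNIV J sm[OF pp[OF c d]]])
    have dP: "anchor_deriv A Z (\<lambda>y. P y (\<beta> y) (\<gamma> y)) x =
        (\<Sum>k\<in>I. p k * anchor_deriv A Z (\<lambda>y. \<beta> y (a k y) * \<gamma> y (b k y)) x)" if Z: "Z \<in> sections A" for Z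
      unfolding P_def
      by (simp only: anchor_deriv_fun_sum[OF A Z I sm[OF pp[OF a b]]])
         (rule sum.cong[OF refl], rule anchor_deriv_fun(2)[OF A Z pp[OF a b] pp[OF a b]])
    have dQ: "anchor_deriv A Z (\<lambda>y. Q y (\<beta> y) (\<gamma> y)) x =
        (\<Sum>l\<in>J. q l * anchor_deriv A Z (\<lambda>y. \<beta> y (c l y) * \<gamma> y (d l y)) x)" if Z: "Z \<in> sections A" for Z
      unfolding Q_def
      by (simp only: anchor_deriv_fun_sum[OF A Z J sm[OF pp[OF c d]]])
         (rule sum.cong[OF refl], rule anchor_deriv_fun(2)[OF A Z pp[OF c d] pp[OF c d]])
    have bf: "k \<in> I \<Longrightarrow> b k x \<in> fibre A x" and df: "l \<in> J \<Longrightarrow> d l x \<in> fibre A x" for k l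
      using b[of k] d[of l] by (simp_all add: sections_def)
    have t1: "anchor_deriv A (\<lambda>y. sharp A P y (\<alpha> y)) (\<lambda>y. Q y (\<beta> y) (\<gamma> y)) x =
        (\<Sum>k\<in>I. \<Sum>l\<in>J. p k * q l * (\<alpha> x (a k x) * anchor_deriv A (b k) (\<lambda>y. \<beta> y (c l y) * \<gamma> y (d l y)) x))"
    proof -
      have "anchor_deriv A (\<lambda>y. \<Sum>k\<in>I. (p k * \<alpha> y (a k y)) *\<^sub>R b k y) (\<lambda>y. Q y (\<beta> y) (\<gamma> y)) x =
          (\<Sum>k\<in>I. (p k * \<alpha> x (a k x)) * anchor_deriv A (b k) (\<lambda>y. Q y (\<beta> y) (\<gamma> y)) x)"
        by (rule anchor_deriv_sum[where X = b, OF A fQ I bf]) simp_all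
      also have "\<dots> = (\<Sum>k\<in>I. \<Sum>l\<in>J. p k * q l * (\<alpha> x (a k x) * anchor_deriv A (b k) (\<lambda>y. \<beta> y (c l y) * \<gamma> y (d l y)) x))"
        by (intro sum.cong refl) (simp add: dQ[OF b] sum_distrib_left ac_simps)
      finally show ?thesis unfolding sP[OF \<alpha>] .
    qed
    have t2: "anchor_deriv A (\<lambda>y. sharp A Q y (\<alpha> y)) (\<lambda>y. P y (\<beta> y) (\<gamma> y)) x =
        (\<Sum>k\<in>I. \<Sum>l\<in>J. p k * q l * (\<alpha> x (c l x) * anchor_deriv A (d l) (\<lambda>y. \<beta> y (a k y) * \<gamma> y (b k y)) x))"
    proof -
      have "anchor_deriv A (\<lambda>y. \<Sum>l\<in>J. (q l * \<alpha> y (c l y)) *\<^sub>R d l y) (\<lambda>y. P y (\<beta> y) (\<gamma> y)) x =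
          (\<Sum>l\<in>J. (q l * \<alpha> x (c l x)) * anchor_deriv A (d l) (\<lambda>y. P y (\<beta> y) (\<gamma> y)) x)"
        by (rule anchor_deriv_sum[where X = d, OF A fP J df]) simp_all
      also have "\<dots> = (\<Sum>l\<in>J. \<Sum>k\<in>I. p k * q l * (\<alpha> x (c l x) * anchor_deriv A (d l) (\<lambda>y. \<beta> y (a k y) * \<gamma> y (b k y)) x))"
        by (intro sum.cong refl) (simp add: dP[OF d] sum_distrib_left ac_simps)
      also have "\<dots> = (\<Sum>k\<in>I. \<Sum>l\<in>J. p k * q l * (\<alpha> x (c l x) * anchor_deriv A (d l) (\<lambda>y. \<beta> y (a k y) * \<gamma> y (b k y)) x))"
        by (rule sum.swap)
      finally show ?thesis unfolding sQ[OF \<alpha>] .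
    qed
    have dd: "d_one A \<alpha> (\<lambda>y. \<Sum>k\<in>I. (p k * \<beta> y (a k y)) *\<^sub>R b k y) (\<lambda>y. \<Sum>l\<in>J. (q l * \<gamma> y (c l y)) *\<^sub>R d l y) x =
        (\<Sum>k\<in>I. \<Sum>l\<in>J. p k * q l * (\<beta> x (a k x) * \<gamma> x (c l x) * d_one A \<alpha> (b k) (d l) x))"
      if \<beta>: "\<beta> \<in> dual_sections A" and \<gamma>: "\<gamma> \<in> dual_sections A" for \<beta> \<gamma>
    proof -
      have "d_one A \<alpha> (\<lambda>y. \<Sum>k\<in>I. (p k * \<beta> y (a k y)) *\<^sub>R b k y) (\<lambda>y. \<Sum>l\<in>J. (q l * \<gamma> y (c l y)) *\<^sub>R d l y) x =
        (\<Sum>l\<in>J. (q l * \<gamma> x (c l x)) * - d_one A \<alpha> (d l) (\<lambda>y. \<Sum>k\<in>I. (p k * \<beta> y (a k y)) *\<^sub>R b k y) x)"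
        by (subst d_one_sum[OF A \<alpha> secP[OF \<beta>] J pr[OF \<gamma> c] d], assumption+)
           (simp add: d_one_skew[OF A \<alpha> secP[OF \<beta>] d, of _ x])
      also have "\<dots> = (\<Sum>l\<in>J. (q l * \<gamma> x (c l x)) * (\<Sum>k\<in>I. (p k * \<beta> x (a k x)) * d_one A \<alpha> (b k) (d l) x))"
        by (rule sum.cong[OF refl])
           (simp add: d_one_sum[OF A \<alpha> d I pr[OF \<beta> a] b] d_one_skew[OF A \<alpha> d b, of _ _ x] sum_negf)
      also have "\<dots> = (\<Sum>k\<in>I. \<Sum>l\<in>J. p k * q l * (\<beta> x (a k x) * \<gamma> x (c l x) * d_one A \<alpha> (b k) (d l) x))"
        by (subst sum.swap) (simp add: sum_distrib_left algebra_simps)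
      finally show ?thesis .
    qed
    have t4: "d_one A \<alpha> (\<lambda>y. \<Sum>l\<in>J. (q l * \<beta> y (c l y)) *\<^sub>R d l y) (\<lambda>y. \<Sum>k\<in>I. (p k * \<gamma> y (a k y)) *\<^sub>R b k y) x =
        (\<Sum>k\<in>I. \<Sum>l\<in>J. p k * q l * (\<beta> x (c l x) * \<gamma> x (a k x) * d_one A \<alpha> (d l) (b k) x))"
      unfolding d_one_skew[OF A \<alpha> secQ[OF \<beta>] secP[OF \<gamma>]] dd[OF \<gamma> \<beta>] sum_negf[symmetric]
      by (intro sum.cong refl) (simp add: d_one_skew[OF A \<alpha> d b, of _ _ x])
    show ?thesis
      unfolding t1 t2 sP[OF \<beta>] sP[OF \<gamma>] sQ[OF \<beta>] sQ[OF \<gamma>] dd[OF \<beta> \<gamma>] t4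
      by (simp add: schouten_term_def sum.distrib[symmetric] sum_subtractf[symmetric] right_diff_distrib distrib_left)
  qed
  show ?thesis
    unfolding schouten_def Let_def main[OF \<alpha> \<beta> \<gamma>] main[OF \<beta> \<gamma> \<alpha>] main[OF \<gamma> \<alpha> \<beta>]
    by (simp add: sum.distrib[symmetric] distrib_left)
qed

lemma schouten_term_wedge:
  fixes A :: "('m::{t2_space,second_countable_topology}, 'v::real_vector, 'z) algebroid_scheme" and x :: 'm
  assumes A: "lie_algebroid A" and X: "X \<in> sections A" and Y: "Y \<in> sections A"
    and U: "U \<in> sections A" and V: "V \<in> sections A"
    and \<alpha>: "\<alpha> \<in> dual_sections A" and \<beta>: "\<beta> \<in> dual_sections A" and \<gamma>: "\<gamma> \<in> dual_sections A"
  defines "s \<equiv> \<lambda>a b c d. schouten_term A a b c d \<alpha> \<beta> \<gamma> x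
      + schouten_term A a b c d \<beta> \<gamma> \<alpha> x + schouten_term A a b c d \<gamma> \<alpha> \<beta> x"
  shows "s X Y U V - s Y X U V - s X Y V U + s Y X V U =
      wedge_three (bracket A X U) Y V \<alpha> \<beta> \<gamma> x - wedge_three (bracket A X V) Y U \<alpha> \<beta> \<gamma> x
      - wedge_three (bracket A Y U) X V \<alpha> \<beta> \<gamma> x + wedge_three (bracket A Y V) X U \<alpha> \<beta> \<gamma> x"
proof -
  have E: "vector_bundle A" using lie_algebroid_imp[OF A] by simp
  have mult: "anchor_deriv A Z (\<lambda>y. \<kappa> y (S y) * \<mu> y (T y)) x =
      \<kappa> x (S x) * anchor_deriv A Z (\<lambda>y. \<mu> y (T y)) x + \<mu> x (T x) * anchor_deriv A Z (\<lambda>y. \<kappa> y (S y)) x"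
    if "Z \<in> sections A" "S \<in> sections A" "T \<in> sections A" "\<kappa> \<in> dual_sections A" "\<mu> \<in> dual_sections A"
    for Z S T \<kappa> \<mu>
    by (rule anchor_deriv_fun(3)[OF A that(1) smooth_pairing[OF E that(4,2)] smooth_pairing[OF E that(5,3)]])
  have neg: "\<kappa> x (bracket A S T x) = - \<kappa> x (bracket A T S x)"
    if "\<kappa> \<in> dual_sections A" "S \<in> sections A" "T \<in> sections A" for \<kappa> S T
    using d_one_skew[OF A that, of x] by (simp add: d_one_def)
  note b = neg[OF \<alpha> U X] neg[OF \<alpha> U Y] neg[OF \<alpha> V X] neg[OF \<alpha> V Y]
    neg[OF \<beta> U X] neg[OF \<beta> U Y] neg[OF \<beta> V X] neg[OF \<beta> V Y]
    neg[OF \<gamma> U X] neg[OF \<gamma> U Y] neg[OF \<gamma> V X] neg[OF \<gamma> V Y]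
  show ?thesis
    unfolding s_def schouten_term_def wedge_three_def d_one_def
    unfolding b
    by (simp only: mult X Y U V \<alpha> \<beta> \<gamma>) (simp add: algebra_simps)
qed

theorem schouten_wedge_sum:
  fixes A :: "('m::{t2_space,second_countable_topology}, 'v::real_vector, 'z) algebroid_scheme"
  assumes A: "lie_algebroid A" and I: "finite I" and J: "finite J"
    and X: "\<And>k. k \<in> I \<Longrightarrow> X k \<in> sections A" and Y: "\<And>k. k \<in> I \<Longrightarrow> Y k \<in> sections A"
    and U: "\<And>l. l \<in> J \<Longrightarrow> U l \<in> sections A" and V: "\<And>l. l \<in> J \<Longrightarrow> V l \<in> sections A"
    and \<alpha>: "\<alpha> \<in> dual_sections A" and \<beta>: "\<beta> \<in> dual_sections A" and \<gamma>: "\<gamma> \<in> dual_sections A"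
  shows "schouten A (wedge_sum I X Y) (wedge_sum J U V) \<alpha> \<beta> \<gamma> x =
     (\<Sum>k\<in>I. \<Sum>l\<in>J.
        wedge_three (bracket A (X k) (U l)) (Y k) (V l) \<alpha> \<beta> \<gamma> x
      - wedge_three (bracket A (X k) (V l)) (Y k) (U l) \<alpha> \<beta> \<gamma> x
      - wedge_three (bracket A (Y k) (U l)) (X k) (V l) \<alpha> \<beta> \<gamma> x
      + wedge_three (bracket A (Y k) (V l)) (X k) (U l) \<alpha> \<beta> \<gamma> x)"
proof -
  define p where "p = (\<lambda>i :: 'a \<times> bool. if snd i then 1 else - 1 :: real)"
  define q where "q = (\<lambda>i :: 'b \<times> bool. if snd i then 1 else - 1 :: real)"
  define a where "a = (\<lambda>i :: 'a \<times> bool. if snd i then X (fst i) else Y (fst i))"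
  define b where "b = (\<lambda>i :: 'a \<times> bool. if snd i then Y (fst i) else X (fst i))"
  define c where "c = (\<lambda>i :: 'b \<times> bool. if snd i then U (fst i) else V (fst i))"
  define d where "d = (\<lambda>i :: 'b \<times> bool. if snd i then V (fst i) else U (fst i))"
  have sum2: "(\<Sum>i\<in>K \<times> UNIV. h i) = (\<Sum>k\<in>K. h (k, True) + h (k, False))"
    for K :: "'k set" and h :: "'k \<times> bool \<Rightarrow> real"
    using sum.cartesian_product[of "\<lambda>k t. h (k, t)" UNIV K] by (simp add: UNIV_bool add.commute)
  have P: "wedge_sum I X Y = (\<lambda>x \<phi> \<psi>. \<Sum>i\<in>I \<times> UNIV. p i * (\<phi> (a i x) * \<psi> (b i x)))"
    by (intro ext) (simp add: wedge_sum_def sum2 p_def a_def b_def)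
  have Q: "wedge_sum J U V = (\<lambda>x \<phi> \<psi>. \<Sum>i\<in>J \<times> UNIV. q i * (\<phi> (c i x) * \<psi> (d i x)))"
    by (intro ext) (simp add: wedge_sum_def sum2 q_def c_def d_def)
  have "schouten A (wedge_sum I X Y) (wedge_sum J U V) \<alpha> \<beta> \<gamma> x =
     (\<Sum>i\<in>I \<times> UNIV. \<Sum>j\<in>J \<times> UNIV. p i * q j *
     (schouten_term A (a i) (b i) (c j) (d j) \<alpha> \<beta> \<gamma> x
      + schouten_term A (a i) (b i) (c j) (d j) \<beta> \<gamma> \<alpha> x
      + schouten_term A (a i) (b i) (c j) (d j) \<gamma> \<alpha> \<beta> x))"
    unfolding P Q
    by (rule schouten_tensor_sum[OF A _ _ _ _ _ _ \<alpha> \<beta> \<gamma>])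
       (use I J X Y U V in \<open>auto simp: a_def b_def c_def d_def\<close>)
  also have "\<dots> = (\<Sum>k\<in>I. \<Sum>l\<in>J.
        wedge_three (bracket A (X k) (U l)) (Y k) (V l) \<alpha> \<beta> \<gamma> x
      - wedge_three (bracket A (X k) (V l)) (Y k) (U l) \<alpha> \<beta> \<gamma> x
      - wedge_three (bracket A (Y k) (U l)) (X k) (V l) \<alpha> \<beta> \<gamma> x
      + wedge_three (bracket A (Y k) (V l)) (X k) (U l) \<alpha> \<beta> \<gamma> x)"
    unfolding sum2 sum.distrib[symmetric]
  proof (intro sum.cong refl, goal_cases)
    case (1 k l)
    show ?case
      unfolding schouten_term_wedge[OF A X[OF 1(1)] Y[OF 1(1)] U[OF 1(2)] V[OF 1(2)] \<alpha> \<beta> \<gamma>, of x, symmetric]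
      by (simp add: p_def q_def a_def b_def c_def d_def)
  qed
  finally show ?thesis .
qed

end

theory Submission
  imports Defs
begin

text \<open>
  Since \<open>\<epsilon>\<^sub>1 \<epsilon>\<^sub>2 \<epsilon>\<^sub>3 = 1\<close>, the endomorphisms \<open>I = \<pi>\<^sub>1\<^sup>\<sharp> \<omega>\<^sub>3\<^sup>\<flat>\<close> and \<open>J = \<pi>\<^sub>1\<^sup>\<sharp> \<omega>\<^sub>2\<^sup>\<flat>\<close> commute; they satisfy
  \<open>I\<^sup>2 = \<epsilon>\<^sub>2\<close>, \<open>J\<^sup>2 = \<epsilon>\<^sub>3\<close>, \<open>\<omega>\<^sub>3 = \<omega>\<^sub>1 I\<close>, \<open>\<omega>\<^sub>2 = \<omega>\<^sub>1 J\<close> and \<open>g = \<epsilon>\<^sub>2 \<epsilon>\<^sub>3 \<omega>\<^sub>1 I J\<close>.  Closedness of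
  \<open>\<omega>\<^sub>1\<close>, \<open>\<omega>\<^sub>1 I\<close> and \<open>\<omega>\<^sub>1 J\<close> forces that of \<open>\<omega>\<^sub>1 I J\<close>, without any Nijenhuis torsion
  argument, so \<open>g\<close> is symplectic.  Moreover \<open>g = c \<omega>\<^sub>i K\<close> with \<open>c\<^sup>2 = 1\<close> and \<open>K\<^sup>2 = \<epsilon>\<^sub>i\<close> for each \<open>i\<close>,
  whence \<open>g\<^sup>\<flat> \<pi>\<^sub>i\<^sup>\<sharp> g\<^sup>\<flat> = \<epsilon>\<^sub>i \<omega>\<^sub>i\<^sup>\<flat>\<close> and \<open>\<omega>\<^sub>i\<^sup>\<flat> (g\<^sup>\<flat>)\<^sup>-\<^sup>1 \<omega>\<^sub>i\<^sup>\<flat> = \<epsilon>\<^sub>i g\<^sup>\<flat>\<close> are closed.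
\<close>

section \<open>Pointwise linear algebra\<close>

lemma dualD:
  assumes "\<phi> \<in> dual E x"
  shows "u \<in> fibre E x \<Longrightarrow> v \<in> fibre E x \<Longrightarrow> \<phi> (u + v) = \<phi> u + \<phi> v"
    and "u \<in> fibre E x \<Longrightarrow> \<phi> (c *\<^sub>R u) = c * \<phi> u"
    and "v \<notin> fibre E x \<Longrightarrow> \<phi> v = 0"
  using assms unfolding dual_def by blast+

lemma dual_add: "\<phi> \<in> dual E x \<Longrightarrow> \<psi> \<in> dual E x \<Longrightarrow> (\<lambda>v. \<phi> v + \<psi> v) \<in> dual E x"
  unfolding dual_def by (auto simp: algebra_simps)

lemma dual_scale: "\<phi> \<in> dual E x \<Longrightarrow> (\<lambda>v. c * \<phi> v) \<in> dual E x"
  unfolding dual_def by (auto simp: algebra_simps)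

lemma dual_zero: "(\<lambda>v. 0) \<in> dual E x"
  unfolding dual_def by auto

lemma dual_lincomb:
  assumes "finite I" "\<And>i. i \<in> I \<Longrightarrow> \<psi> i \<in> dual E x"
  shows "(\<lambda>v. \<Sum>i\<in>I. a i * \<psi> i v) \<in> dual E x"
  using assms by (induction I rule: finite_induct) (simp_all add: dual_zero dual_add dual_scale)

lemma dual_sum_scaleR:
  assumes E: "vector_bundle E" and \<phi>: "\<phi> \<in> dual E x" and "finite I"
    and u: "\<And>i. i \<in> I \<Longrightarrow> u i \<in> fibre E x"
  shows "\<phi> (\<Sum>i\<in>I. a i *\<^sub>R u i) = (\<Sum>i\<in>I. a i * \<phi> (u i))"
  using u by (simp add: dual_sum[OF E \<phi> \<open>finite I\<close>] subspace_scale[OF fibre_subspace[OF E]] dualD[OF \<phi>])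

text \<open>Off the fibre both sides vanish, because covectors are extended by 0; hence an equality
  of functions, which can be substituted inside a bivector whose smoothness is known only on
  coframes.\<close>

lemma dual_expansion:
  assumes E: "vector_bundle E" and e: "(U, e) \<in> frames E" "x \<in> U" and \<phi>: "\<phi> \<in> dual E x"
  shows "\<phi> = (\<lambda>v. \<Sum>i<rk E. \<phi> (e i x) * coframe E e x i v)"
proof
  fix v
  show "\<phi> v = (\<Sum>i<rk E. \<phi> (e i x) * coframe E e x i v)"
  proof (cases "v \<in> fibre E x")
    case True
    have "\<phi> v = \<phi> (\<Sum>i<rk E. coframe E e x i v *\<^sub>R e i x)"
      using frame_expansion[OF E e True] by simp
    also have "\<dots> = (\<Sum>i<rk E. coframe E e x i v * \<phi> (e i x))"
      using frame_in_fibre[OF E e] by (intro dual_sum_scaleR[OF E \<phi>]) auto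
    finally show ?thesis by (simp add: mult.commute)
  next
    case False
    then show ?thesis by (simp add: dualD(3)[OF \<phi>] dualD(3)[OF coframe_dual[OF E e]])
  qed
qed

lemma two_formD:
  assumes "two_form E \<omega>" "u \<in> fibre E x" "v \<in> fibre E x" "w \<in> fibre E x"
  shows "\<omega> x (u + v) w = \<omega> x u w + \<omega> x v w" "\<omega> x (c *\<^sub>R u) w = c * \<omega> x u w"
    "\<omega> x u w = - \<omega> x w u"
  using assms unfolding two_form_def by blast+

lemma two_form_skew:
  assumes "two_form E \<omega>" "u \<in> fibre E x" "w \<in> fibre E x"
  shows "\<omega> x u w = - \<omega> x w u"
  using two_formD(3)[OF assms(1,2,2,3)] .

lemma flat_apply: "v \<in> fibre E x \<Longrightarrow> flat E \<omega> x u v = \<omega> x u v"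
  by (simp add: flat_def)

lemma flat_eqI:
  assumes "\<And>v. v \<in> fibre E x \<Longrightarrow> \<omega> x u v = \<omega>' x u' v"
  shows "flat E \<omega> x u = flat E \<omega>' x u'"
  using assms by (auto simp: flat_def)

text \<open>\<open>two_form\<close> states linearity in the first argument only; skewness carries it
  to the second.\<close>

lemma flat_in_dual:
  assumes E: "vector_bundle E" and \<omega>: "two_form E \<omega>" and u: "u \<in> fibre E x"
  shows "flat E \<omega> x u \<in> dual E x"
proof -
  note S = subspace_add[OF fibre_subspace[OF E]] subspace_scale[OF fibre_subspace[OF E]]
  have "\<omega> x u (v + w) = \<omega> x u v + \<omega> x u w" "\<omega> x u (c *\<^sub>R v) = c * \<omega> x u v"
    if "v \<in> fibre E x" "w \<in> fibre E x" for v w c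
    using two_formD(1)[OF \<omega> that u] two_formD(2)[OF \<omega> that(1,1) u, of c] S(1)[OF that] S(2)[OF that(1), of c]
      two_form_skew[OF \<omega> u] that by simp_all
  then show ?thesis
    using S by (auto simp: dual_def flat_def)
qed

lemma bivector_fieldD:
  assumes "bivector_field E \<pi>" "\<phi> \<in> dual E x" "\<psi> \<in> dual E x" "\<theta> \<in> dual E x"
  shows "\<pi> x (\<lambda>v. \<phi> v + \<psi> v) \<theta> = \<pi> x \<phi> \<theta> + \<pi> x \<psi> \<theta>"
    "\<pi> x (\<lambda>v. c * \<phi> v) \<theta> = c * \<pi> x \<phi> \<theta>" "\<pi> x \<phi> \<theta> = - \<pi> x \<theta> \<phi>"
  using assms unfolding bivector_field_def by blast+

lemma bivector_skew:
  assumes "bivector_field E \<pi>" "\<phi> \<in> dual E x" "\<psi> \<in> dual E x"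
  shows "\<pi> x \<phi> \<psi> = - \<pi> x \<psi> \<phi>"
  using bivector_fieldD(3)[OF assms(1,2,2,3)] .

lemma bivector_lincomb:
  assumes \<pi>: "bivector_field E \<pi>" and \<theta>: "\<theta> \<in> dual E x"
    and "finite I" "\<And>i. i \<in> I \<Longrightarrow> \<psi> i \<in> dual E x"
  shows "\<pi> x (\<lambda>v. \<Sum>i\<in>I. a i * \<psi> i v) \<theta> = (\<Sum>i\<in>I. a i * \<pi> x (\<psi> i) \<theta>)"
  using assms(3,4)
proof (induction I rule: finite_induct)
  case empty
  show ?case using bivector_fieldD(2)[OF \<pi> dual_zero dual_zero \<theta>, of 0] by simp
next
  case (insert i I)
  have "\<pi> x (\<lambda>v. a i * \<psi> i v + (\<Sum>i\<in>I. a i * \<psi> i v)) \<theta> =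
      \<pi> x (\<lambda>v. a i * \<psi> i v) \<theta> + \<pi> x (\<lambda>v. \<Sum>i\<in>I. a i * \<psi> i v) \<theta>"
    using insert by (intro bivector_fieldD(1)[OF \<pi> _ _ \<theta>] dual_scale dual_lincomb) auto
  then show ?case
    using insert bivector_fieldD(2)[OF \<pi> _ _ \<theta>, of "\<psi> i" "\<psi> i" "a i"] by simp
qed

text \<open>\<open>sharp\<close> is a definite description, so a vector satisfying it must be
  exhibited. In a local frame it is the sum of the \<open>\<pi>(\<phi>, e^i) e_i\<close>; skewness
  moves \<open>\<psi>\<close> to the first slot, where it is expanded in the coframe. Covectors
  separate points of the fibre, which gives uniqueness.\<close>

lemma sharp_props:
  assumes E: "vector_bundle E" and \<pi>: "bivector_field E \<pi>" and \<phi>: "\<phi> \<in> dual E x"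
  shows "sharp E \<pi> x \<phi> \<in> fibre E x" and "\<psi> \<in> dual E x \<Longrightarrow> \<psi> (sharp E \<pi> x \<phi>) = \<pi> x \<phi> \<psi>"
proof -
  obtain U e where e: "(U, e) \<in> frames E" "x \<in> U"
    using vector_bundleD(3)[OF E] by blast
  note c = coframe_dual[OF E e]
  define v where "v = (\<Sum>i<rk E. \<pi> x \<phi> (coframe E e x i) *\<^sub>R e i x)"
  have v: "v \<in> fibre E x"
    unfolding v_def using frame_in_fibre[OF E e]
    by (intro subspace_sum subspace_scale fibre_subspace[OF E]) auto
  have ev: "\<psi> v = \<pi> x \<phi> \<psi>" if \<psi>: "\<psi> \<in> dual E x" for \<psi>
  proof -
    have "\<pi> x \<phi> \<psi> = - \<pi> x (\<lambda>v. \<Sum>i<rk E. \<psi> (e i x) * coframe E e x i v) \<phi>"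
      using bivector_skew[OF \<pi> \<phi> \<psi>] dual_expansion[OF E e \<psi>] by simp
    also have "\<dots> = (\<Sum>i<rk E. \<psi> (e i x) * \<pi> x \<phi> (coframe E e x i))"
      by (simp add: bivector_lincomb[OF \<pi> \<phi>] c sum_negf[symmetric] bivector_skew[OF \<pi> \<phi> c])
    also have "\<dots> = \<psi> v"
      unfolding v_def using frame_in_fibre[OF E e]
      by (subst dual_sum_scaleR[OF E \<psi>]) (auto simp: mult.commute)
    finally show ?thesis ..
  qed
  have "sharp E \<pi> x \<phi> = v"
    unfolding sharp_def
  proof (rule the_equality)
    show "v \<in> fibre E x \<and> (\<forall>\<psi>\<in>dual E x. \<psi> v = \<pi> x \<phi> \<psi>)" using v ev by blast
    show "w = v" if "w \<in> fibre E x \<and> (\<forall>\<psi>\<in>dual E x. \<psi> w = \<pi> x \<phi> \<psi>)" for w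
      using that ev by (intro dual_separates[OF E _ v]) auto
  qed
  then show "sharp E \<pi> x \<phi> \<in> fibre E x" "\<psi> \<in> dual E x \<Longrightarrow> \<psi> (sharp E \<pi> x \<phi>) = \<pi> x \<phi> \<psi>"
    using v ev by simp_all
qed

section \<open>Smoothness of the musical maps\<close>

text \<open>The component is the sum over \<open>j\<close> of
  \<open>\<alpha>(e_j) \<pi>(e^j, e^i)\<close>. The hypotheses on \<open>\<alpha>\<close> concern
  \<open>U\<close> alone, so that the members of the coframe, defined only locally, may be inserted
  for \<open>\<alpha>\<close>.\<close>

lemma coframe_sharp_smooth:
  assumes E: "vector_bundle E" and \<pi>: "bivector_field E \<pi>" and e: "(U, e) \<in> frames E"
    and \<alpha>: "\<And>x. x \<in> U \<Longrightarrow> \<alpha> x \<in> dual E x"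
    and s: "\<And>j. j < rk E \<Longrightarrow> smooth_fun_on E U (\<lambda>x. \<alpha> x (e j x))" and i: "i < rk E"
  shows "smooth_fun_on E U (\<lambda>x. coframe E e x i (sharp E \<pi> x (\<alpha> x)))"
proof -
  note M = vector_bundleD(1)[OF E] and U = vector_bundleD(4)[OF E e]
  have "smooth_fun_on E U (\<lambda>x. \<Sum>j<rk E. \<alpha> x (e j x) * \<pi> x (coframe E e x j) (coframe E e x i))"
    using \<pi> e i s unfolding bivector_field_def
    by (intro smooth_fun_on_sum smooth_fun_on_mult M U) auto
  moreover have "(\<Sum>j<rk E. \<alpha> x (e j x) * \<pi> x (coframe E e x j) (coframe E e x i)) =
      coframe E e x i (sharp E \<pi> x (\<alpha> x))" if x: "x \<in> U" for x
  proof -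
    note c = coframe_dual[OF E e x]
    have "coframe E e x i (sharp E \<pi> x (\<alpha> x)) = \<pi> x (\<alpha> x) (coframe E e x i)"
      by (rule sharp_props(2)[OF E \<pi> \<alpha>[OF x] c])
    also have "\<dots> = \<pi> x (\<lambda>v. \<Sum>j<rk E. \<alpha> x (e j x) * coframe E e x j v) (coframe E e x i)"
      using dual_expansion[OF E e x \<alpha>[OF x]] by simp
    finally show ?thesis by (simp add: bivector_lincomb[OF \<pi> c] c)
  qed
  ultimately show ?thesis by (rule smooth_fun_on_cong[OF M U])
qed

lemma flat_frame_smooth:
  assumes E: "vector_bundle E" and \<omega>: "two_form E \<omega>" and e: "(U, e) \<in> frames E"
    and X: "\<And>x. x \<in> U \<Longrightarrow> X x \<in> fibre E x"
    and s: "\<And>i. i < rk E \<Longrightarrow> smooth_fun_on E U (\<lambda>x. coframe E e x i (X x))" and j: "j < rk E"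
  shows "smooth_fun_on E U (\<lambda>x. flat E \<omega> x (X x) (e j x))"
proof -
  note M = vector_bundleD(1)[OF E] and U = vector_bundleD(4)[OF E e]
  have "smooth_fun_on E U (\<lambda>x. \<Sum>i<rk E. coframe E e x i (X x) * \<omega> x (e i x) (e j x))"
    using \<omega> e j s unfolding two_form_def
    by (intro smooth_fun_on_sum smooth_fun_on_mult M U) auto
  moreover have "(\<Sum>i<rk E. coframe E e x i (X x) * \<omega> x (e i x) (e j x)) = flat E \<omega> x (X x) (e j x)"
    if x: "x \<in> U" for x
  proof -
    note f = frame_in_fibre[OF E e x]
    \<comment> \<open>\<open>X\<close> goes to the second slot, where its expansion is evaluated by
      the covector \<open>flat E \<omega> x (e j x)\<close>; a second use of skewness restores the
      order.\<close>
    have "flat E \<omega> x (X x) (e j x) = - flat E \<omega> x (e j x) (X x)"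
      using two_form_skew[OF \<omega> X[OF x] f[OF j]] by (simp add: flat_apply X[OF x] f[OF j])
    also have "\<dots> = - flat E \<omega> x (e j x) (\<Sum>i<rk E. coframe E e x i (X x) *\<^sub>R e i x)"
      using frame_expansion[OF E e x X[OF x]] by simp
    also have "\<dots> = - (\<Sum>i<rk E. coframe E e x i (X x) * \<omega> x (e j x) (e i x))"
      using f by (subst dual_sum_scaleR[OF E flat_in_dual[OF E \<omega> f[OF j]]]) (auto simp: flat_apply)
    also have "\<dots> = (\<Sum>i<rk E. coframe E e x i (X x) * \<omega> x (e i x) (e j x))"
      using two_form_skew[OF \<omega> f[OF j] f] by (simp add: sum_negf[symmetric])
    finally show ?thesis ..
  qed
  ultimately show ?thesis by (rule smooth_fun_on_cong[OF M U])
qed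

lemma sharp_section:
  assumes E: "vector_bundle E" and \<pi>: "bivector_field E \<pi>" and \<alpha>: "\<alpha> \<in> dual_sections E"
  shows "(\<lambda>x. sharp E \<pi> x (\<alpha> x)) \<in> sections E"
  using \<alpha> sharp_props(1)[OF E \<pi>] unfolding sections_def dual_sections_def
  by (fastforce intro!: coframe_sharp_smooth[OF E \<pi>])

lemma flat_dual_section:
  assumes E: "vector_bundle E" and \<omega>: "two_form E \<omega>" and X: "X \<in> sections E"
  shows "(\<lambda>x. flat E \<omega> x (X x)) \<in> dual_sections E"
  using X flat_in_dual[OF E \<omega>] unfolding sections_def dual_sections_def
  by (fastforce intro!: flat_frame_smooth[OF E \<omega>])

lemma two_form_smooth:
  assumes E: "vector_bundle E" and \<omega>: "two_form E \<omega>" and X: "X \<in> sections E" and Y: "Y \<in> sections E"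
  shows "smooth_fun E (\<lambda>x. \<omega> x (X x) (Y x))"
  using smooth_pairing[OF E flat_dual_section[OF E \<omega> X] Y] Y by (simp add: flat_def sections_def)

section \<open>Closed forms and their inverses\<close>

text \<open>The tensors are compared on fibres only, since their values elsewhere are arbitrary;
  every argument that occurs in \<open>d_two\<close> lies in a fibre.\<close>

lemma closed_form_scale:
  assumes A: "lie_algebroid A" and \<omega>: "two_form A \<omega>" and cl: "closed_form A \<omega>"
    and \<eta>: "\<And>x u v. u \<in> fibre A x \<Longrightarrow> v \<in> fibre A x \<Longrightarrow> \<eta> x u v = c * \<omega> x u v"
  shows "closed_form A \<eta>"
  unfolding closed_form_def
proof (intro ballI allI)
  fix X Y Z x assume S: "X \<in> sections A" "Y \<in> sections A" "Z \<in> sections A"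
  note E = lie_algebroid_imp(1)[OF A]
  have e: "\<eta> y (S y) (T y) = c * \<omega> y (S y) (T y)" if "S \<in> sections A" "T \<in> sections A" for S T y
    using that by (intro \<eta>) (auto simp: sections_def)
  have a: "anchor_deriv A S (\<lambda>y. c * \<omega> y (T y) (V y)) x = c * anchor_deriv A S (\<lambda>y. \<omega> y (T y) (V y)) x"
    if "S \<in> sections A" "T \<in> sections A" "V \<in> sections A" for S T V
    using anchor_deriv_fun(2)[OF A that(1)] two_form_smooth[OF E \<omega> that(2,3)] by blast
  have "d_two A \<eta> X Y Z x = c * d_two A \<omega> X Y Z x"
    unfolding d_two_def using S lie_algebroidD(6)[OF A]
    by (simp add: e a algebra_simps)
  then show "d_two A \<eta> X Y Z x = 0"
    using cl S by (simp add: closed_form_def)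
qed

lemma d_two_skew:
  assumes A: "lie_algebroid A" and \<omega>: "two_form A \<omega>"
    and S: "X \<in> sections A" "Y \<in> sections A" "Z \<in> sections A"
  shows "d_two A \<omega> Y X Z x = - d_two A \<omega> X Y Z x" "d_two A \<omega> X Z Y x = - d_two A \<omega> X Y Z x"
proof -
  note E = lie_algebroid_imp(1)[OF A] and br = lie_algebroidD(6)[OF A]
  have f: "T \<in> sections A \<Longrightarrow> T y \<in> fibre A y" for T y by (simp add: sections_def)
  have b: "\<omega> x (bracket A T V x) (W x) = - \<omega> x (bracket A V T x) (W x)"
    if "T \<in> sections A" "V \<in> sections A" "W \<in> sections A" for T V W
  proof -
    have "bracket A T V x = (-1) *\<^sub>R bracket A V T x"
      using lie_algebroidD(8)[OF A that(1,2)] by simp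
    then show ?thesis
      using two_formD(2)[OF \<omega> f f f, OF br br that(3), OF that(2,1) that(2,1), where c = "-1"] by simp
  qed
  have a: "anchor_deriv A T (\<lambda>y. \<omega> y (V y) (W y)) x = - anchor_deriv A T (\<lambda>y. \<omega> y (W y) (V y)) x"
    if "T \<in> sections A" "V \<in> sections A" "W \<in> sections A" for T V W
  proof -
    have "(\<lambda>y. \<omega> y (V y) (W y)) = (\<lambda>y. (-1) * \<omega> y (W y) (V y))"
      using two_form_skew[OF \<omega> f f, OF that(2,3)] by auto
    then show ?thesis
      using anchor_deriv_fun(2)[OF A that(1) two_form_smooth[OF E \<omega> that(3,2)] two_form_smooth[OF E \<omega> that(3,2)], where c = "-1" and x = x]
      by simp
  qed
  show "d_two A \<omega> Y X Z x = - d_two A \<omega> X Y Z x"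
    unfolding d_two_def using b[OF S(2,1,3)] a[OF S(3,2,1)] by simp
  show "d_two A \<omega> X Z Y x = - d_two A \<omega> X Y Z x"
    unfolding d_two_def using b[OF S(3,2,1)] a[OF S(1,3,2)] by simp
qed

text \<open>A cyclic permutation is a product of two adjacent transpositions, so the signs
  cancel.\<close>

lemma d_two_rotate:
  assumes "lie_algebroid A" "two_form A \<omega>" "X \<in> sections A" "Y \<in> sections A" "Z \<in> sections A"
  shows "d_two A \<omega> X Y Z x = d_two A \<omega> Z X Y x"
  using d_two_skew(1)[OF assms(1-3,5,4), of x] d_two_skew(2)[OF assms, of x] by simp

lemma inverse_bivectorD:
  assumes "inverse_bivector E \<omega> \<pi>"
  shows "bivector_field E \<pi>" "\<phi> \<in> dual E x \<Longrightarrow> flat E \<omega> x (sharp E \<pi> x \<phi>) = \<phi>"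
    "u \<in> fibre E x \<Longrightarrow> sharp E \<pi> x (flat E \<omega> x u) = u"
  using assms unfolding inverse_bivector_def by blast+

text \<open>Writing \<open>\<alpha> = \<omega>\<^sup>\<flat> X\<close> and so on, \<open>[\<pi>, \<pi>](\<alpha>, \<beta>, \<gamma>)\<close> becomes \<open>2 d\<omega>(X, Y, Z)\<close>.\<close>

lemma inverse_of_closed_poisson:
  assumes A: "lie_algebroid A" and \<omega>: "two_form A \<omega>" and cl: "closed_form A \<omega>"
    and inv: "inverse_bivector A \<omega> \<pi>"
  shows "poisson A \<pi>"
  unfolding poisson_def
proof (intro ballI allI)
  fix \<alpha> \<beta> \<gamma> x
  assume D: "\<alpha> \<in> dual_sections A" "\<beta> \<in> dual_sections A" "\<gamma> \<in> dual_sections A"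
  note E = lie_algebroid_imp(1)[OF A] and \<pi> = inverse_bivectorD(1)[OF inv]
  define s where "s = (\<lambda>\<kappa> y. sharp A \<pi> y (\<kappa> y))"
  have sec: "s \<kappa> \<in> sections A" if "\<kappa> \<in> dual_sections A" for \<kappa>
    unfolding s_def by (rule sharp_section[OF E \<pi> that])
  have f: "T \<in> sections A \<Longrightarrow> T y \<in> fibre A y" for T y by (simp add: sections_def)
  have dl: "\<kappa> \<in> dual_sections A \<Longrightarrow> \<kappa> y \<in> dual A y" for \<kappa> y by (simp add: dual_sections_def)
  have pair: "\<kappa> y (T y) = \<omega> y (s \<kappa> y) (T y)" if "\<kappa> \<in> dual_sections A" "T \<in> sections A" for \<kappa> T y
    using fun_cong[OF inverse_bivectorD(2)[OF inv dl[OF that(1)]], of y "T y"] f[OF that(2)]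
    by (simp add: flat_apply s_def)
  \<comment> \<open>The order is reversed:
    \<open>\<pi>(\<kappa>, \<mu>) = \<mu>(s \<kappa>)\<close>, and
    \<open>\<mu> = \<omega>(s \<mu>, -)\<close>.\<close>
  have piv: "\<pi> y (\<kappa> y) (\<mu> y) = \<omega> y (s \<mu> y) (s \<kappa> y)" if "\<kappa> \<in> dual_sections A" "\<mu> \<in> dual_sections A" for \<kappa> \<mu> y
    using sharp_props(2)[OF E \<pi> dl dl, OF that, of y] pair[OF that(2) sec[OF that(1)], of y]
    by (simp add: s_def)
  have w: "\<omega> y (S y) (T y) = - \<omega> y (T y) (S y)" if "S \<in> sections A" "T \<in> sections A" for S T y
    by (rule two_form_skew[OF \<omega> f f, OF that])
  have a: "anchor_deriv A T (\<lambda>y. \<omega> y (V y) (W y)) x = - anchor_deriv A T (\<lambda>y. \<omega> y (W y) (V y)) x"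
    if "T \<in> sections A" "V \<in> sections A" "W \<in> sections A" for T V W
    using anchor_deriv_fun(2)[OF A that(1) two_form_smooth[OF E \<omega> that(3,2)] two_form_smooth[OF E \<omega> that(3,2)], where c = "-1" and x = x]
      w[OF that(2,3)] by simp
  note S = sec[OF D(1)] sec[OF D(2)] sec[OF D(3)]
  note br = lie_algebroidD(6)[OF A]
  \<comment> \<open>For equal bivectors each cyclic summand of \<open>schouten\<close> is twice the
    left side. In the cyclic sum of the right sides each derivative occurs once with a minus and
    twice with a plus, which leaves one copy, as in \<open>d_two\<close>.\<close>
  have t: "anchor_deriv A (s \<kappa>) (\<lambda>y. \<pi> y (\<mu> y) (\<nu> y)) x - d_one A \<kappa> (s \<mu>) (s \<nu>) x =
     - anchor_deriv A (s \<kappa>) (\<lambda>y. \<omega> y (s \<mu> y) (s \<nu> y)) x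
     + anchor_deriv A (s \<mu>) (\<lambda>y. \<omega> y (s \<nu> y) (s \<kappa> y)) x
     + anchor_deriv A (s \<nu>) (\<lambda>y. \<omega> y (s \<kappa> y) (s \<mu> y)) x
     - \<omega> x (bracket A (s \<mu>) (s \<nu>) x) (s \<kappa> x)"
    if "\<kappa> \<in> dual_sections A" "\<mu> \<in> dual_sections A" "\<nu> \<in> dual_sections A" for \<kappa> \<mu> \<nu>
    using a[OF sec sec sec, OF that(1,3,2)] a[OF sec sec sec, OF that(2,1,3)]
      w[OF sec[OF that(1)] br[OF sec sec, OF that(2,3)], of x]
    by (simp add: d_one_def piv[OF that(2,3)] pair[OF that(1) sec[OF that(2)]]
        pair[OF that(1) sec[OF that(3)]] pair[OF that(1) br[OF sec sec, OF that(2,3)]])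
  have cyc: "\<omega> x (bracket A (s \<gamma>) (s \<alpha>) x) (s \<beta> x) = - \<omega> x (bracket A (s \<alpha>) (s \<gamma>) x) (s \<beta> x)"
  proof -
    have "bracket A (s \<gamma>) (s \<alpha>) x = (-1) *\<^sub>R bracket A (s \<alpha>) (s \<gamma>) x"
      using lie_algebroidD(8)[OF A S(3,1)] by simp
    then show ?thesis
      using two_formD(2)[OF \<omega> f f f, OF br[OF S(1,3)] br[OF S(1,3)] S(2), where c = "-1"] by simp
  qed
  have "schouten A \<pi> \<pi> \<alpha> \<beta> \<gamma> x = 2 * d_two A \<omega> (s \<alpha>) (s \<beta>) (s \<gamma>) x"
    using t[OF D] t[OF D(2,3,1)] t[OF D(3,1,2)] a[OF S(2,1,3)] cyc
    unfolding schouten_def Let_def d_two_def s_def by simp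
  then show "schouten A \<pi> \<pi> \<alpha> \<beta> \<gamma> x = 0"
    using cl S by (simp add: closed_form_def)
qed

text \<open>For commuting \<open>I\<close>, \<open>J\<close>, the form \<open>\<tau> = d(\<omega> I J)\<close> is
  \<open>- \<omega>([J X, I Y] - I [J X, Y] - J [X, I Y] + I J [X, Y], Z)\<close>.  When \<open>I\<^sup>2\<close> is a constant, moving
  \<open>I\<close> from one argument of \<open>\<tau>\<close> to another changes the sign; moving it around all three
  arguments gives \<open>\<tau>(I X, Y, Z) = - \<tau>(I X, Y, Z)\<close>.\<close>

lemma closed_form_composition:
  assumes A: "lie_algebroid A"
    and tf: "two_form A \<omega>" "two_form A \<omega>I" "two_form A \<omega>J" "two_form A \<eta>"
    and cl: "closed_form A \<omega>" "closed_form A \<omega>I" "closed_form A \<omega>J"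
    and I: "\<And>X. X \<in> sections A \<Longrightarrow> (\<lambda>x. I x (X x)) \<in> sections A"
    and J: "\<And>X. X \<in> sections A \<Longrightarrow> (\<lambda>x. J x (X x)) \<in> sections A"
    and I_fibre: "\<And>x u. u \<in> fibre A x \<Longrightarrow> I x u \<in> fibre A x"
    and J_fibre: "\<And>x u. u \<in> fibre A x \<Longrightarrow> J x u \<in> fibre A x"
    and \<omega>I: "\<And>x u v. u \<in> fibre A x \<Longrightarrow> v \<in> fibre A x \<Longrightarrow> \<omega>I x u v = \<omega> x (I x u) v"
    and \<omega>J: "\<And>x u v. u \<in> fibre A x \<Longrightarrow> v \<in> fibre A x \<Longrightarrow> \<omega>J x u v = \<omega> x (J x u) v"
    and \<eta>: "\<And>x u v. u \<in> fibre A x \<Longrightarrow> v \<in> fibre A x \<Longrightarrow> \<eta> x u v = \<omega> x (I x (J x u)) v"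
    and II: "\<And>x u. u \<in> fibre A x \<Longrightarrow> I x (I x u) = c *\<^sub>R u" and c: "c \<noteq> 0"
  shows "closed_form A \<eta>"
proof -
  note E = lie_algebroid_imp(1)[OF A] and br = lie_algebroidD(6)[OF A]
  have f: "T \<in> sections A \<Longrightarrow> T y \<in> fibre A y" for T y by (simp add: sections_def)
  note skew = two_form_skew[OF tf(1)] two_form_skew[OF tf(2)] two_form_skew[OF tf(3)] two_form_skew[OF tf(4)]
  \<comment> \<open>Skewness of \<open>\<omega>I\<close> and \<open>\<omega>J\<close> makes
    \<open>I\<close> and \<open>J\<close> self-adjoint for \<open>\<omega>\<close>; skewness of
    \<open>\<eta>\<close> encodes their commutation, in the form
    \<open>\<omega>J (I u) v = \<eta> u v\<close>.\<close>
  have mv: "\<omega> x u (I x v) = \<omega>I x u v" "\<omega> x u (J x v) = \<omega>J x u v"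
    "\<omega>I x (J x u) v = \<eta> x u v" "\<omega>J x u (I x v) = \<eta> x u v"
    "\<omega>I x u (I x v) = c * \<omega> x u v" "\<omega>J x (I x u) v = \<eta> x u v" "\<eta> x u (I x v) = c * \<omega>J x u v"
    "\<omega>I x u (J x v) = \<eta> x u v"
    if u: "u \<in> fibre A x" and v: "v \<in> fibre A x" for x u v
  proof -
    note IJ = I_fibre[OF u] I_fibre[OF v] J_fibre[OF u] J_fibre[OF v]
    have IJ': "I x (J x u) \<in> fibre A x" "I x (J x v) \<in> fibre A x" using IJ(3,4) I_fibre by blast+
    show "\<omega> x u (I x v) = \<omega>I x u v"
      using skew(1)[OF u IJ(2)] skew(2)[OF u v] \<omega>I[OF v u] by simp
    show "\<omega> x u (J x v) = \<omega>J x u v"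
      using skew(1)[OF u IJ(4)] skew(3)[OF u v] \<omega>J[OF v u] by simp
    show "\<omega>I x (J x u) v = \<eta> x u v"
      using \<eta>[OF u v] \<omega>I[OF IJ(3) v] by simp
    show "\<omega>I x u (J x v) = \<eta> x u v"
      using \<eta>[OF v u] \<omega>I[OF IJ(4) u] skew(2)[OF u IJ(4)] skew(4)[OF u v] by simp
    have a: "\<omega>J x p (I x q) = \<eta> x p q" if p: "p \<in> fibre A x" and q: "q \<in> fibre A x" for p q
      using \<omega>J[OF p I_fibre[OF q]] \<omega>I[OF J_fibre[OF p] q] \<eta>[OF p q]
        skew(1)[OF J_fibre[OF p] I_fibre[OF q]] skew(2)[OF J_fibre[OF p] q] \<omega>I[OF q J_fibre[OF p]] by simp
    show "\<omega>J x u (I x v) = \<eta> x u v" using a[OF u v] .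
    show "\<omega>J x (I x u) v = \<eta> x u v"
      using a[OF v u] skew(3)[OF v IJ(1)] skew(4)[OF u v] by simp
    show "\<omega>I x u (I x v) = c * \<omega> x u v"
      using \<omega>I[OF IJ(2) u] skew(2)[OF u IJ(2)] II[OF v] two_formD(2)[OF tf(1) v v u, of c] skew(1)[OF u v]
      by simp
    show "\<eta> x u (I x v) = c * \<omega>J x u v"
      using a[OF u IJ(2)] II[OF v] two_formD(2)[OF tf(3) v v u, of c] skew(3)[OF u v]
        subspace_scale[OF fibre_subspace[OF E] v, of c] skew(3)[OF u, of "c *\<^sub>R v"] by simp
  qed
  have main: "d_two A \<eta> X Y Z x = - (\<omega> x (bracket A (\<lambda>x. J x (X x)) (\<lambda>x. I x (Y x)) x) (Z x)
      - \<omega>I x (bracket A (\<lambda>x. J x (X x)) Y x) (Z x) - \<omega>J x (bracket A X (\<lambda>x. I x (Y x)) x) (Z x)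
      + \<eta> x (bracket A X Y x) (Z x))"
    if S: "X \<in> sections A" "Y \<in> sections A" "Z \<in> sections A" for X Y Z x
  proof -
    note F = f[OF S(1)] f[OF S(2)] f[OF S(3)] and IS = I[OF S(2)] and JS = J[OF S(1)]
    note B = f[OF br[OF S(1,2)]] f[OF br[OF S(1,3)]] f[OF br[OF S(2,3)]] f[OF br[OF JS S(3)]] f[OF br[OF IS S(3)]]
    \<comment> \<open>In this alternating combination all derivative terms and all brackets with
      \<open>Z\<close> cancel in pairs; only brackets of the first two arguments remain. The last
      three differentials vanish by closedness.\<close>
    have "d_two A \<eta> X Y Z x - d_two A \<omega>I (\<lambda>x. J x (X x)) Y Z x - d_two A \<omega>J X (\<lambda>x. I x (Y x)) Z x
        + d_two A \<omega> (\<lambda>x. J x (X x)) (\<lambda>x. I x (Y x)) Z x =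
      - (\<omega> x (bracket A (\<lambda>x. J x (X x)) (\<lambda>x. I x (Y x)) x) (Z x)
      - \<omega>I x (bracket A (\<lambda>x. J x (X x)) Y x) (Z x) - \<omega>J x (bracket A X (\<lambda>x. I x (Y x)) x) (Z x)
      + \<eta> x (bracket A X Y x) (Z x))"
      by (simp add: d_two_def mv \<omega>I[symmetric] \<omega>J[symmetric] F I_fibre J_fibre B)
    then show ?thesis
      using cl S IS JS by (simp add: closed_form_def)
  qed
  have anti: "d_two A \<eta> X (\<lambda>x. I x (Y x)) Z x = - d_two A \<eta> X Y (\<lambda>x. I x (Z x)) x"
    if S: "X \<in> sections A" "Y \<in> sections A" "Z \<in> sections A" for X Y Z x
  proof -
    have Ic: "(\<lambda>x. I x (I x (Y x))) = (\<lambda>x. c *\<^sub>R Y x)" using II f[OF S(2)] by auto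
    \<comment> \<open>Constancy of \<open>c\<close> enters here: for a nonconstant factor the
      Leibniz rule would add an anchor term.\<close>
    have bc: "bracket A T (\<lambda>x. c *\<^sub>R Y x) x = c *\<^sub>R bracket A T Y x" if "T \<in> sections A" for T
      using A that S(2) unfolding lie_algebroid_def by blast
    note B = br[OF S(1,2)] br[OF S(1) I[OF S(2)]] br[OF J[OF S(1)] S(2)] br[OF J[OF S(1)] I[OF S(2)]]
    note Bf = f[OF B(1)] f[OF B(2)] f[OF B(3)] f[OF B(4)] f[OF S(3)]
    show ?thesis
      unfolding main[OF S(1) I[OF S(2)] S(3)] main[OF S(1,2) I[OF S(3)]] Ic bc[OF S(1)] bc[OF J[OF S(1)]]
      by (simp add: mv Bf two_formD(2)[OF tf(1) Bf(3,3,5)] two_formD(2)[OF tf(3) Bf(1,1,5)])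
  qed
  \<comment> \<open>\<open>anti\<close> moves \<open>I\<close> from the second slot to the third;
    rotations bring each pair of neighbours into these slots. The full circuit takes three moves,
    hence an odd number of signs.\<close>
  have zero: "d_two A \<eta> (\<lambda>x. I x (X x)) Y Z x = 0"
    if S: "X \<in> sections A" "Y \<in> sections A" "Z \<in> sections A" for X Y Z x
  proof -
    note IX = I[OF S(1)] and IY = I[OF S(2)] and IZ = I[OF S(3)]
    note rot = d_two_rotate[OF A tf(4)]
    have "d_two A \<eta> (\<lambda>x. I x (X x)) Y Z x = d_two A \<eta> Z (\<lambda>x. I x (X x)) Y x"
      by (rule rot[OF IX S(2,3)])
    also have "\<dots> = - d_two A \<eta> Z X (\<lambda>x. I x (Y x)) x" by (rule anti[OF S(3,1,2)])
    also have "\<dots> = - d_two A \<eta> X (\<lambda>x. I x (Y x)) Z x" by (simp only: rot[OF S(1) IY S(3)])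
    also have "\<dots> = d_two A \<eta> X Y (\<lambda>x. I x (Z x)) x" by (simp only: anti[OF S] minus_minus)
    also have "\<dots> = d_two A \<eta> Y (\<lambda>x. I x (Z x)) X x" by (rule rot[OF S(2) IZ S(1), symmetric])
    also have "\<dots> = - d_two A \<eta> Y Z (\<lambda>x. I x (X x)) x" by (rule anti[OF S(2,3,1)])
    also have "\<dots> = - d_two A \<eta> (\<lambda>x. I x (X x)) Y Z x" by (simp only: rot[OF S(2,3) IX])
    finally show ?thesis by simp
  qed
  show ?thesis
    unfolding closed_form_def
  proof (intro ballI allI)
    fix X Y Z x assume S: "X \<in> sections A" "Y \<in> sections A" "Z \<in> sections A"
    \<comment> \<open>\<open>X = I (I (X / c))\<close>, so every section is in the image of
      \<open>I\<close> and \<open>zero\<close> applies.\<close>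
    have X': "(\<lambda>y. (1 / c) *\<^sub>R X y) \<in> sections A"
      by (rule sections_scale[OF E smooth_fun_on_const[OF lie_algebroid_imp(2)[OF A] open_UNIV] S(1)])
    have "(\<lambda>x. I x (I x ((1 / c) *\<^sub>R X x))) = X"
      using II f[OF X'] c by auto
    then show "d_two A \<eta> X Y Z x = 0"
      using zero[OF I[OF X'] S(2,3), of x] by simp
  qed
qed

section \<open>Tensors built from pairs of symplectic forms\<close>

lemma frame_coframe_smooth:
  assumes "vector_bundle E" "(U, e) \<in> frames E" "i < rk E" "j < rk E"
  shows "smooth_fun_on E U (\<lambda>x. coframe E e x i (e j x))"
proof -
  have "smooth_fun_on E (U \<inter> U) (\<lambda>x. coframe E e x i (e j x))"
    using assms unfolding vector_bundle_def by blast
  then show ?thesis by simp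
qed

lemma flat_scaleR:
  assumes "vector_bundle E" "two_form E \<omega>" "u \<in> fibre E x"
  shows "flat E \<omega> x (c *\<^sub>R u) = (\<lambda>v. c * flat E \<omega> x u v)"
  using two_formD(2)[OF assms(2,3,3)] by (auto simp: flat_def)

lemma sharp_flat_in_fibre:
  assumes "vector_bundle E" "bivector_field E \<pi>" "two_form E \<omega>" "u \<in> fibre E x"
  shows "sharp E \<pi> x (flat E \<omega> x u) \<in> fibre E x"
  by (rule sharp_props(1)[OF assms(1,2) flat_in_dual[OF assms(1,3,4)]])

lemma form_sharp_flat:
  assumes E: "vector_bundle E" and inv: "inverse_bivector E \<omega> \<pi>" and \<omega>': "two_form E \<omega>'"
    and u: "u \<in> fibre E x" and v: "v \<in> fibre E x"
  shows "\<omega> x (sharp E \<pi> x (flat E \<omega>' x u)) v = \<omega>' x u v"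
  using fun_cong[OF inverse_bivectorD(2)[OF inv flat_in_dual[OF E \<omega>' u]], of v] v
  by (simp add: flat_apply)

text \<open>Homogeneity is obtained by passing through \<open>flat E \<omega>\<close>, whose inverse
  is \<open>sharp E \<pi>\<close>.\<close>

lemma sharp_flat_scaleR:
  assumes E: "vector_bundle E" and \<omega>: "two_form E \<omega>" and inv: "inverse_bivector E \<omega> \<pi>"
    and \<omega>': "two_form E \<omega>'" and u: "u \<in> fibre E x"
  shows "sharp E \<pi> x (flat E \<omega>' x (c *\<^sub>R u)) = c *\<^sub>R sharp E \<pi> x (flat E \<omega>' x u)"
proof -
  define s where "s = sharp E \<pi> x (flat E \<omega>' x u)"
  have s: "s \<in> fibre E x"
    unfolding s_def by (rule sharp_flat_in_fibre[OF E inverse_bivectorD(1)[OF inv] \<omega>' u])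
  have "flat E \<omega>' x (c *\<^sub>R u) = flat E \<omega> x (c *\<^sub>R s)"
    unfolding flat_scaleR[OF E \<omega>' u] flat_scaleR[OF E \<omega> s]
    unfolding s_def inverse_bivectorD(2)[OF inv flat_in_dual[OF E \<omega>' u]] ..
  then show ?thesis
    using inverse_bivectorD(3)[OF inv subspace_scale[OF fibre_subspace[OF E] s]] by (simp add: s_def)
qed

text \<open>A composite of musical maps need not be skew, hence the hypothesis. Linearity in the
  second slot comes from \<open>\<omega>\<close>, and skewness transfers it to the first. Smoothness
  follows by applying the musical maps one after another to the frame vectors.\<close>

lemma two_form_flat_sharp_flat:
  assumes E: "vector_bundle E" and \<omega>: "two_form E \<omega>" and \<pi>: "bivector_field E \<pi>" and \<omega>': "two_form E \<omega>'"
    and \<eta>: "\<And>x u v. u \<in> fibre E x \<Longrightarrow> v \<in> fibre E x \<Longrightarrow>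
      \<eta> x u v = c * \<omega> x (sharp E \<pi> x (flat E \<omega>' x u)) v"
    and skew: "\<And>x u v. u \<in> fibre E x \<Longrightarrow> v \<in> fibre E x \<Longrightarrow> \<eta> x u v = - \<eta> x v u"
  shows "two_form E \<eta>"
proof -
  note S = subspace_add[OF fibre_subspace[OF E]] subspace_scale[OF fibre_subspace[OF E]]
  let ?K = "\<lambda>x u. sharp E \<pi> x (flat E \<omega>' x u)"
  note K = sharp_flat_in_fibre[OF E \<pi> \<omega>']
  note M = vector_bundleD(1)[OF E]
  have lin: "\<eta> x u (v + w) = \<eta> x u v + \<eta> x u w" "\<eta> x u (a *\<^sub>R v) = a * \<eta> x u v"
    if u: "u \<in> fibre E x" and v: "v \<in> fibre E x" and w: "w \<in> fibre E x" for x u v w a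
    using dualD(1)[OF flat_in_dual[OF E \<omega> K[OF u]] v w] dualD(2)[OF flat_in_dual[OF E \<omega> K[OF u]] v, of a]
    by (simp_all add: \<eta> u v w S flat_apply distrib_left)
  have "\<eta> x (u + v) w = \<eta> x u w + \<eta> x v w \<and> (\<forall>a. \<eta> x (a *\<^sub>R u) w = a * \<eta> x u w) \<and> \<eta> x u w = - \<eta> x w u"
    if u: "u \<in> fibre E x" and v: "v \<in> fibre E x" and w: "w \<in> fibre E x" for x u v w
  proof (intro conjI allI)
    show "\<eta> x (u + v) w = \<eta> x u w + \<eta> x v w"
      unfolding skew[OF S(1)[OF u v] w] skew[OF u w] skew[OF v w] lin(1)[OF w u v] by simp
    show "\<eta> x (a *\<^sub>R u) w = a * \<eta> x u w" for a
      unfolding skew[OF S(2)[OF u] w] skew[OF u w] lin(2)[OF w u u] by simp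
  qed (rule skew[OF u w])
  moreover have "smooth_fun_on E U (\<lambda>x. \<eta> x (e i x) (e j x))"
    if e: "(U, e) \<in> frames E" and i: "i < rk E" and j: "j < rk E" for U e i j
  proof -
    note U = vector_bundleD(4)[OF E e] and f = frame_in_fibre[OF E e]
    have "smooth_fun_on E U (\<lambda>x. flat E \<omega> x (?K x (e i x)) (e j x))"
      using f[OF _ i] frame_coframe_smooth[OF E e _ i] K flat_in_dual[OF E \<omega>']
      by (intro flat_frame_smooth[OF E \<omega> e _ _ j] coframe_sharp_smooth[OF E \<pi> e]
          flat_frame_smooth[OF E \<omega>' e]) auto
    then have "smooth_fun_on E U (\<lambda>x. c * flat E \<omega> x (?K x (e i x)) (e j x))"
      by (intro smooth_fun_on_mult smooth_fun_on_const M U)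
    then show ?thesis
      by (rule smooth_fun_on_cong[OF M U]) (simp add: \<eta> f i j flat_apply)
  qed
  ultimately show ?thesis
    unfolding two_form_def by blast
qed

section \<open>Inverses of twisted symplectic forms\<close>

text \<open>With \<open>r\<close> the inverse of \<open>flat E g x\<close>, the value at
  \<open>\<phi>, \<psi>\<close> is \<open>\<psi>(r \<phi>) = g(r \<psi>, r \<phi>)\<close>, so it is
  skew because \<open>g\<close> is. Linearity is immediate in the second slot and passes to the
  first by skewness.\<close>

lemma inverse_tensor_props:
  assumes E: "vector_bundle E" and g: "two_form E g"
    and bij: "\<And>x. bij_betw (flat E g x) (fibre E x) (dual E x)"
    and smooth: "\<And>U e i j. (U, e) \<in> frames E \<Longrightarrow> i < rk E \<Longrightarrow> j < rk E \<Longrightarrow>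
      smooth_fun_on E U (\<lambda>x. inverse_tensor E g x (coframe E e x i) (coframe E e x j))"
  shows "inverse_bivector E g (inverse_tensor E g)"
proof -
  let ?P = "inverse_tensor E g" and ?r = "\<lambda>x. inv_into (fibre E x) (flat E g x)"
  have r: "?r x \<phi> \<in> fibre E x" "flat E g x (?r x \<phi>) = \<phi>" if "\<phi> \<in> dual E x" for x \<phi>
    using bij[of x] that by (auto simp: bij_betw_def intro: inv_into_into f_inv_into_f)
  have rl: "?r x (flat E g x u) = u" if "u \<in> fibre E x" for x u
    using bij[of x] that by (auto simp: bij_betw_def)
  have val: "?P x \<phi> \<psi> = g x (?r x \<psi>) (?r x \<phi>)" if "\<phi> \<in> dual E x" "\<psi> \<in> dual E x" for x \<phi> \<psi>
    using fun_cong[OF r(2)[OF that(2)], of "?r x \<phi>"] r(1)[OF that(1)]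
    by (simp add: inverse_tensor_def flat_apply)
  have skew: "?P x \<phi> \<psi> = - ?P x \<psi> \<phi>" if "\<phi> \<in> dual E x" "\<psi> \<in> dual E x" for x \<phi> \<psi>
    using val[OF that] val[OF that(2,1)] two_form_skew[OF g r(1)[OF that(1)] r(1)[OF that(2)]] by simp
  have "?P x (\<lambda>v. \<phi> v + \<psi> v) \<theta> = ?P x \<phi> \<theta> + ?P x \<psi> \<theta> \<and>
      (\<forall>c. ?P x (\<lambda>v. c * \<phi> v) \<theta> = c * ?P x \<phi> \<theta>) \<and> ?P x \<phi> \<theta> = - ?P x \<theta> \<phi>"
    if "\<phi> \<in> dual E x" "\<psi> \<in> dual E x" "\<theta> \<in> dual E x" for x \<phi> \<psi> \<theta>
    unfolding skew[OF dual_add[OF that(1,2)] that(3)] skew[OF dual_scale[OF that(1)] that(3)]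
      skew[OF that(1,3)] skew[OF that(2,3)]
    by (simp add: inverse_tensor_def)
  with smooth have P: "bivector_field E ?P"
    unfolding bivector_field_def by blast
  have sh: "sharp E ?P x \<phi> = ?r x \<phi>" if "\<phi> \<in> dual E x" for x \<phi>
    using sharp_props[OF E P that] by (intro dual_separates[OF E _ r(1)[OF that]]) (auto simp: inverse_tensor_def)
  show ?thesis
    unfolding inverse_bivector_def using P sh r rl flat_in_dual[OF E g] by simp
qed

text \<open>The flat map of \<open>g\<close> is \<open>c \<omega>\<^sup>\<flat> K\<close> with
  \<open>K\<^sup>2 = a\<close> and \<open>c\<^sup>2 = 1\<close>; its inverse is
  \<open>(c / a) K \<pi>\<^sup>\<sharp>\<close>, a composite of smooth musical maps.\<close>

lemma inverse_tensor_twist: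
  assumes E: "vector_bundle E" and \<omega>: "two_form E \<omega>" and inv: "inverse_bivector E \<omega> \<pi>"
    and \<omega>': "two_form E \<omega>'" and \<pi>': "bivector_field E \<pi>'" and g: "two_form E g"
    and gK: "\<And>x u v. u \<in> fibre E x \<Longrightarrow> v \<in> fibre E x \<Longrightarrow>
      g x u v = c * \<omega> x (sharp E \<pi>' x (flat E \<omega>' x u)) v"
    and KK: "\<And>x u. u \<in> fibre E x \<Longrightarrow>
      sharp E \<pi>' x (flat E \<omega>' x (sharp E \<pi>' x (flat E \<omega>' x u))) = a *\<^sub>R u"
    and c: "c * c = 1" and a: "a \<noteq> 0"
  shows "inverse_bivector E g (inverse_tensor E g)"
proof (rule inverse_tensor_props[OF E g])
  let ?K = "\<lambda>x u. sharp E \<pi>' x (flat E \<omega>' x u)"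
  note K = sharp_flat_in_fibre[OF E \<pi>' \<omega>'] and \<pi> = inverse_bivectorD(1)[OF inv]
  note S = subspace_scale[OF fibre_subspace[OF E]] and M = vector_bundleD(1)[OF E]
  have fg: "flat E g x u = flat E \<omega> x (c *\<^sub>R ?K x u)" if u: "u \<in> fibre E x" for x u
    by (rule flat_eqI) (simp add: gK[OF u] two_formD(2)[OF \<omega> K[OF u] K[OF u]])
  have inj: "inj_on (flat E g x) (fibre E x)" for x
  proof (rule inj_onI)
    fix u v assume u: "u \<in> fibre E x" and v: "v \<in> fibre E x" and eq: "flat E g x u = flat E g x v"
    have "c *\<^sub>R ?K x u = c *\<^sub>R ?K x v"
      using arg_cong[OF eq, of "sharp E \<pi> x"]
      by (simp only: fg[OF u] fg[OF v] inverse_bivectorD(3)[OF inv S[OF K[OF u]]] inverse_bivectorD(3)[OF inv S[OF K[OF v]]])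
    then have "?K x u = ?K x v" using c by auto
    then have "?K x (?K x u) = ?K x (?K x v)" by simp
    then show "u = v" using a by (simp add: KK u v)
  qed
  have r: "(c / a) *\<^sub>R ?K x (sharp E \<pi> x \<phi>) \<in> fibre E x"
    "flat E g x ((c / a) *\<^sub>R ?K x (sharp E \<pi> x \<phi>)) = \<phi>" if \<phi>: "\<phi> \<in> dual E x" for x \<phi>
  proof -
    let ?s = "sharp E \<pi> x \<phi>"
    have s: "?s \<in> fibre E x" by (rule sharp_props(1)[OF E \<pi> \<phi>])
    show "(c / a) *\<^sub>R ?K x ?s \<in> fibre E x" by (intro S K s)
    have "flat E g x ((c / a) *\<^sub>R ?K x ?s) = flat E \<omega> x ?s"
    proof (rule flat_eqI)
      fix v assume v: "v \<in> fibre E x"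
      have "g x ((c / a) *\<^sub>R ?K x ?s) v = (c / a) * (c * (a * \<omega> x ?s v))"
        using two_formD(2)[OF g K[OF s] K[OF s] v] two_formD(2)[OF \<omega> s s v, of a]
        by (simp add: gK[OF K[OF s] v] KK[OF s])
      also have "\<dots> = (c * c) * \<omega> x ?s v" using a by simp
      finally show "g x ((c / a) *\<^sub>R ?K x ?s) v = \<omega> x ?s v" using c by simp
    qed
    then show "flat E g x ((c / a) *\<^sub>R ?K x ?s) = \<phi>"
      by (simp add: inverse_bivectorD(2)[OF inv \<phi>])
  qed
  show "bij_betw (flat E g x) (fibre E x) (dual E x)" for x
    unfolding bij_betw_def
  proof (intro conjI inj equalityI subsetI)
    fix \<phi> assume "\<phi> \<in> dual E x"
    then show "\<phi> \<in> flat E g x ` fibre E x" using r by (metis imageI)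
  qed (auto intro: flat_in_dual[OF E g])
  fix U e i j assume e: "(U, e) \<in> frames E" and i: "i < rk E" and j: "j < rk E"
  note U = vector_bundleD(4)[OF E e] and cd = coframe_dual[OF E e]
  have "smooth_fun_on E U (\<lambda>x. coframe E e x j (?K x (sharp E \<pi> x (coframe E e x i))))"
    using frame_coframe_smooth[OF E e i] sharp_props(1)[OF E \<pi> cd] flat_in_dual[OF E \<omega>'] cd
    by (intro coframe_sharp_smooth[OF E \<pi>' e _ _ j] flat_frame_smooth[OF E \<omega>' e] coframe_sharp_smooth[OF E \<pi> e]) auto
  then have "smooth_fun_on E U (\<lambda>x. (c / a) * coframe E e x j (?K x (sharp E \<pi> x (coframe E e x i))))"
    by (intro smooth_fun_on_mult smooth_fun_on_const M U)
  moreover have "(c / a) * coframe E e x j (?K x (sharp E \<pi> x (coframe E e x i))) =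
      inverse_tensor E g x (coframe E e x i) (coframe E e x j)" if x: "x \<in> U" for x
  proof -
    have "inv_into (fibre E x) (flat E g x) (coframe E e x i) = (c / a) *\<^sub>R ?K x (sharp E \<pi> x (coframe E e x i))"
      using r[OF cd[OF x]] by (intro inv_into_f_eq[OF inj])
    then show ?thesis
      by (simp add: inverse_tensor_def dualD(2)[OF cd[OF x] K[OF sharp_props(1)[OF E \<pi> cd[OF x]]]])
  qed
  ultimately show "smooth_fun_on E U (\<lambda>x. inverse_tensor E g x (coframe E e x i) (coframe E e x j))"
    by (rule smooth_fun_on_cong[OF M U])
qed

text \<open>Here \<open>\<pi>\<^sup>\<sharp> g\<^sup>\<flat> = c K\<close> and
  \<open>P\<^sup>\<sharp> \<omega>\<^sup>\<flat> = (c / a) K\<close>. Composing with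
  \<open>g\<close> and with \<open>\<omega>\<close> gives the constant multiples
  \<open>a \<omega>\<close> and \<open>(1 / a) g\<close> of closed forms.\<close>

lemma P_Omega_twist:
  assumes A: "lie_algebroid A" and \<omega>: "two_form A \<omega>" "closed_form A \<omega>" and inv: "inverse_bivector A \<omega> \<pi>"
    and g: "two_form A g" "closed_form A g" and inv_g: "inverse_bivector A g P"
    and K: "\<And>x u. u \<in> fibre A x \<Longrightarrow> K x u \<in> fibre A x"
    and gK: "\<And>x u v. u \<in> fibre A x \<Longrightarrow> v \<in> fibre A x \<Longrightarrow> g x u v = c * \<omega> x (K x u) v"
    and KK: "\<And>x u. u \<in> fibre A x \<Longrightarrow> K x (K x u) = a *\<^sub>R u"
    and c: "c * c = 1" and a: "a \<noteq> 0"
  shows "P_Omega A \<pi> g" "P_Omega A P \<omega>"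
proof -
  note E = lie_algebroid_imp(1)[OF A]
  note S = subspace_scale[OF fibre_subspace[OF E]]
  have gKu: "g x (K x u) v = c * (a * \<omega> x u v)" if "u \<in> fibre A x" "v \<in> fibre A x" for x u v
    using gK[OF K[OF that(1)] that(2)] KK[OF that(1)] two_formD(2)[OF \<omega>(1) that(1,1,2)] by simp
  have "g x (sharp A \<pi> x (flat A g x u)) v = a * \<omega> x u v"
    if u: "u \<in> fibre A x" and v: "v \<in> fibre A x" for x u v
  proof -
    have "flat A g x u = flat A \<omega> x (c *\<^sub>R K x u)"
      by (rule flat_eqI) (simp add: gK[OF u] two_formD(2)[OF \<omega>(1) K[OF u] K[OF u]])
    then have "sharp A \<pi> x (flat A g x u) = c *\<^sub>R K x u"
      using inverse_bivectorD(3)[OF inv S[OF K[OF u]]] by simp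
    then have "g x (sharp A \<pi> x (flat A g x u)) v = (c * c) * (a * \<omega> x u v)"
      using two_formD(2)[OF g(1) K[OF u] K[OF u] v] by (simp add: gKu[OF u v])
    then show ?thesis using c by simp
  qed
  from closed_form_scale[OF A \<omega> this]
  show "P_Omega A \<pi> g"
    unfolding P_Omega_def
    using inverse_bivectorD(1)[OF inv] g inverse_of_closed_poisson[OF A \<omega> inv] by blast
  have "\<omega> x (sharp A P x (flat A \<omega> x u)) v = (1 / a) * g x u v"
    if u: "u \<in> fibre A x" and v: "v \<in> fibre A x" for x u v
  proof -
    have "flat A \<omega> x u = flat A g x ((c / a) *\<^sub>R K x u)"
    proof (rule flat_eqI)
      fix w assume w: "w \<in> fibre A x"
      have "g x ((c / a) *\<^sub>R K x u) w = (c * c) * \<omega> x u w"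
        using a by (simp add: two_formD(2)[OF g(1) K[OF u] K[OF u] w] gKu[OF u w])
      then show "\<omega> x u w = g x ((c / a) *\<^sub>R K x u) w" using c by simp
    qed
    then have "sharp A P x (flat A \<omega> x u) = (c / a) *\<^sub>R K x u"
      using inverse_bivectorD(3)[OF inv_g S[OF K[OF u]]] by simp
    then show ?thesis
      using two_formD(2)[OF \<omega>(1) K[OF u] K[OF u] v] by (simp add: gK[OF u v])
  qed
  from closed_form_scale[OF A g this]
  show "P_Omega A P \<omega>"
    unfolding P_Omega_def
    using inverse_bivectorD(1)[OF inv_g] \<omega> inverse_of_closed_poisson[OF A g inv_g] by blast
qed

section \<open>The algebra generated by a hypersymplectic triple\<close>

theorem proposition5p6:
  fixes A :: "('m::{t2_space,second_countable_topology}, 'v::real_vector) algebroid"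
    and \<epsilon> :: "3 \<Rightarrow> real"
    and \<omega> :: "3 \<Rightarrow> ('m, 'v) tensor02"
    and \<pi> :: "3 \<Rightarrow> ('m, 'v) tensor20"
  assumes "lie_algebroid A"
    and "hypersymplectic A \<epsilon> \<omega> \<pi>"
    and "\<epsilon> 1 * \<epsilon> 2 * \<epsilon> 3 = 1"
  shows "\<forall>i. P_Omega A (\<pi> i) (induced_tensor A \<epsilon> \<omega> \<pi>) \<and>
             P_Omega A (inverse_tensor A (induced_tensor A \<epsilon> \<omega> \<pi>)) (\<omega> i)"
proof -
  note A = assms(1) and E = lie_algebroid_imp(1)[OF assms(1)]
  \<comment> \<open>Normal forms for the indices \<open>i - 1\<close> and \<open>i + 1\<close> in
    \<open>transition\<close>.\<close>
  have Z3: "(3::3) = 0" "(- 1::3) = 2" by (simp_all add: neg_eq_iff_add_eq_0)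
  have hyp: "\<epsilon> i = 1 \<or> \<epsilon> i = - 1" "two_form A (\<omega> i)" "closed_form A (\<omega> i)" "inverse_bivector A (\<omega> i) (\<pi> i)"
    "bivector_field A (\<pi> i)" for i
    using assms(2) by (simp_all add: hypersymplectic_def symplectic_form_def inverse_bivector_def)
  have tr: "transition A \<omega> \<pi> i x (transition A \<omega> \<pi> i x u) = \<epsilon> i *\<^sub>R u" if "u \<in> fibre A x" for i x u
    using assms(2) that by (simp add: hypersymplectic_def)
  have \<epsilon>2: "\<epsilon> i * \<epsilon> i = 1" "\<epsilon> i \<noteq> 0" for i using hyp(1)[of i] by auto
  have \<epsilon>13: "\<epsilon> 1 * \<epsilon> 3 = \<epsilon> 2"
    using assms(3) hyp(1)[of 1] hyp(1)[of 2] hyp(1)[of 3] by auto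
  \<comment> \<open>\<open>K\<close>, \<open>I\<close>, \<open>L\<close> are the transition tensors
    of index 1, 2, 3; \<open>J\<close> is the inverse of \<open>L\<close>, so that \<open>I\<close>
    and \<open>J\<close> both start from \<open>\<omega> 1\<close>.\<close>
  define I where "I = (\<lambda>x u. sharp A (\<pi> 1) x (flat A (\<omega> 3) x u))"
  define J where "J = (\<lambda>x u. sharp A (\<pi> 1) x (flat A (\<omega> 2) x u))"
  define K where "K = (\<lambda>x u. sharp A (\<pi> 3) x (flat A (\<omega> 2) x u))"
  define L where "L = (\<lambda>x u. sharp A (\<pi> 2) x (flat A (\<omega> 1) x u))"
  define g where "g = induced_tensor A \<epsilon> \<omega> \<pi>"
  have fib: "I x u \<in> fibre A x" "J x u \<in> fibre A x" "K x u \<in> fibre A x" "L x u \<in> fibre A x"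
    if "u \<in> fibre A x" for x u
    unfolding I_def J_def K_def L_def by (intro sharp_flat_in_fibre[OF E hyp(5,2) that])+
  have eq: "\<omega> 1 x (I x u) v = \<omega> 3 x u v" "\<omega> 1 x (J x u) v = \<omega> 2 x u v"
    if "u \<in> fibre A x" "v \<in> fibre A x" for x u v
    unfolding I_def J_def by (rule form_sharp_flat[OF E hyp(4,2) that])+
  have scale: "I x (c *\<^sub>R u) = c *\<^sub>R I x u" "J x (c *\<^sub>R u) = c *\<^sub>R J x u" if "u \<in> fibre A x" for x u c
    unfolding I_def J_def by (rule sharp_flat_scaleR[OF E hyp(2,4,2) that])+
  have flat_sharp: "flat A (\<omega> i) x (sharp A (\<pi> i) x (flat A (\<omega> j) x u)) = flat A (\<omega> j) x u"
    if "u \<in> fibre A x" for i j x u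
    by (rule inverse_bivectorD(2)[OF hyp(4) flat_in_dual[OF E hyp(2) that]])
  have II: "I x (I x u) = \<epsilon> 2 *\<^sub>R u" and KK: "K x (K x u) = \<epsilon> 1 *\<^sub>R u" and LL: "L x (L x u) = \<epsilon> 3 *\<^sub>R u"
    if "u \<in> fibre A x" for x u
    using tr[OF that, of 2] tr[OF that, of 1] tr[OF that, of 3]
    by (simp_all add: transition_def I_def K_def L_def Z3)
  have LJ: "L x (J x u) = u" and IK: "I x (K x u) = J x u" if u: "u \<in> fibre A x" for x u
    unfolding I_def J_def K_def L_def flat_sharp[OF u] by (simp_all add: inverse_bivectorD(3)[OF hyp(4) u])
  have JJ: "J x (J x u) = \<epsilon> 3 *\<^sub>R u" if u: "u \<in> fibre A x" for x u
  proof -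
    have "\<epsilon> 3 *\<^sub>R J x (J x u) = u"
      using LL[OF fib(2)[OF fib(2)[OF u]]] by (simp add: LJ u fib)
    then have "\<epsilon> 3 *\<^sub>R u = (\<epsilon> 3 * \<epsilon> 3) *\<^sub>R J x (J x u)" by (metis scaleR_scaleR)
    then show ?thesis by (simp add: \<epsilon>2)
  qed
  have IJ: "I x (J x u) = \<epsilon> 2 *\<^sub>R K x u" if u: "u \<in> fibre A x" for x u
    using II[OF fib(3)[OF u]] by (simp add: IK u)
  \<comment> \<open>The sign condition enters through \<open>\<epsilon>13\<close>: without it the
    factor would be \<open>\<epsilon> 1 * \<epsilon> 3\<close>. Together with \<open>IJ\<close> this
    is the commutation of \<open>I\<close> and \<open>J\<close>.\<close>
  have JI: "J x (I x u) = \<epsilon> 2 *\<^sub>R K x u" if u: "u \<in> fibre A x" for x u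
  proof -
    have "J x (K x u) = \<epsilon> 1 *\<^sub>R I x u"
      using IK[OF fib(3)[OF u]] by (simp add: KK u scale)
    then have "\<epsilon> 1 *\<^sub>R J x (I x u) = \<epsilon> 3 *\<^sub>R K x u"
      using JJ[OF fib(3)[OF u]] by (simp add: scale fib u)
    then have "\<epsilon> 1 *\<^sub>R (\<epsilon> 1 *\<^sub>R J x (I x u)) = \<epsilon> 1 *\<^sub>R (\<epsilon> 3 *\<^sub>R K x u)" by simp
    then show ?thesis by (simp add: \<epsilon>2 \<epsilon>13)
  qed
  have g3: "g x u v = (\<epsilon> 3 * \<epsilon> 2) * \<omega> 3 x (J x u) v" if "u \<in> fibre A x" "v \<in> fibre A x" for x u v
    using that by (simp add: g_def induced_tensor_def J_def flat_apply)
  have \<omega>32: "\<omega> 3 x (J x u) v = \<omega> 2 x (I x u) v" if u: "u \<in> fibre A x" and v: "v \<in> fibre A x" for x u v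
    using eq(1)[OF fib(2)[OF u] v] eq(2)[OF fib(1)[OF u] v] by (simp add: IJ JI u)
  have g2: "g x u v = (\<epsilon> 3 * \<epsilon> 2) * \<omega> 2 x (I x u) v" if "u \<in> fibre A x" "v \<in> fibre A x" for x u v
    using g3[OF that] \<omega>32[OF that] by simp
  have g1: "g x u v = \<epsilon> 3 * \<omega> 1 x (K x u) v" if u: "u \<in> fibre A x" and v: "v \<in> fibre A x" for x u v
  proof -
    have "\<omega> 3 x (J x u) v = \<epsilon> 2 * \<omega> 1 x (K x u) v"
      using eq(1)[OF fib(2)[OF u] v] by (simp add: IJ u two_formD(2)[OF hyp(2) fib(3)[OF u] fib(3)[OF u] v])
    then have "g x u v = \<epsilon> 3 * (\<epsilon> 2 * \<epsilon> 2) * \<omega> 1 x (K x u) v"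
      using g3[OF u v] by simp
    then show ?thesis by (simp add: \<epsilon>2)
  qed
  \<comment> \<open>\<open>J\<close> and then \<open>I\<close> are moved across by passing from
    \<open>\<omega> 3\<close> to \<open>\<omega> 1\<close> to \<open>\<omega> 2\<close>;
    \<open>\<omega>32\<close>, that is, commutation, closes the chain.\<close>
  have skew: "\<omega> 3 x (J x u) v = - \<omega> 3 x (J x v) u" if u: "u \<in> fibre A x" and v: "v \<in> fibre A x" for x u v
  proof -
    have "- \<omega> 3 x (J x v) u = \<omega> 3 x u (J x v)"
      using two_form_skew[OF hyp(2) u fib(2)[OF v]] by simp
    also have "\<dots> = - \<omega> 1 x (J x v) (I x u)"
      using eq(1)[OF u fib(2)[OF v]] two_form_skew[OF hyp(2) fib(1)[OF u] fib(2)[OF v]] by simp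
    also have "\<dots> = \<omega> 2 x (I x u) v"
      using eq(2)[OF v fib(1)[OF u]] two_form_skew[OF hyp(2) fib(1)[OF u] v] by simp
    finally show ?thesis using \<omega>32[OF u v] by simp
  qed
  \<comment> \<open>This is \<open>\<omega> 1\<close> composed with \<open>I J\<close>, the shape
    required by \<open>closed_form_composition\<close>; \<open>g\<close> differs from it by the sign
    \<open>\<epsilon> 3 * \<epsilon> 2\<close>.\<close>
  define \<eta> where "\<eta> = (\<lambda>x u v. \<omega> 3 x (J x u) v)"
  note twisted = two_form_flat_sharp_flat[OF E hyp(2)[of 3] hyp(5)[of 1] hyp(2)[of 2]]
  have tf_\<eta>: "two_form A \<eta>"
  proof (rule twisted[of \<eta> 1])
    show "\<eta> x u v = 1 * \<omega> 3 x (sharp A (\<pi> 1) x (flat A (\<omega> 2) x u)) v" for x u v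
      by (simp add: \<eta>_def J_def)
    show "\<eta> x u v = - \<eta> x v u" if "u \<in> fibre A x" "v \<in> fibre A x" for x u v
      unfolding \<eta>_def by (rule skew[OF that])
  qed
  have tf_g: "two_form A g"
  proof (rule twisted[OF g3[unfolded J_def]])
    show "g x u v = - g x v u" if "u \<in> fibre A x" "v \<in> fibre A x" for x u v
      unfolding g3[OF that] g3[OF that(2,1)] skew[OF that] by simp
  qed
  have "closed_form A \<eta>"
  proof (rule closed_form_composition[where c = "\<epsilon> 2" and I = I and J = J, OF A hyp(2)[of 1] hyp(2)[of 3] hyp(2)[of 2] tf_\<eta> hyp(3)[of 1] hyp(3)[of 3] hyp(3)[of 2]])
    show "(\<lambda>x. I x (X x)) \<in> sections A" "(\<lambda>x. J x (X x)) \<in> sections A" if "X \<in> sections A" for X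
      unfolding I_def J_def by (intro sharp_section[OF E hyp(5)] flat_dual_section[OF E hyp(2) that])+
  qed (simp_all add: fib eq \<eta>_def II \<epsilon>2)
  then have cl_g: "closed_form A g"
    by (rule closed_form_scale[OF A tf_\<eta>, of g "\<epsilon> 3 * \<epsilon> 2"]) (simp add: g3 \<eta>_def)
  have c: "(\<epsilon> 3 * \<epsilon> 2) * (\<epsilon> 3 * \<epsilon> 2) = 1"
    using \<epsilon>2(1)[of 2] \<epsilon>2(1)[of 3] by (simp add: mult_ac)
  \<comment> \<open>The representation of \<open>g\<close> by \<open>\<omega> 2\<close> and
    \<open>I\<close> is chosen, since \<open>I\<close> is itself a composite of musical maps with
    known square.\<close>
  have inv_g: "inverse_bivector A g (inverse_tensor A g)"
    by (rule inverse_tensor_twist[OF E hyp(2)[of 2] hyp(4)[of 2] hyp(2)[of 3] hyp(5)[of 1] tf_g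
          g2[unfolded I_def] II[unfolded I_def] c \<epsilon>2(2)[of 2]])
  note twist = P_Omega_twist[OF A hyp(2,3,4) tf_g cl_g inv_g]
  show ?thesis
    unfolding forall_3 g_def[symmetric]
    \<comment> \<open>Indices 1, 2, 3 use \<open>K\<close>, \<open>I\<close>, \<open>J\<close>,
      whose squares are \<open>\<epsilon> 1\<close>, \<open>\<epsilon> 2\<close>,
      \<open>\<epsilon> 3\<close>.\<close>
    using twist[of K, OF fib(3) g1 KK \<epsilon>2] twist[of I, OF fib(1) g2 II c \<epsilon>2(2)]
      twist[of J, OF fib(2) g3 JJ c \<epsilon>2(2)]
    by blast
qed

end
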